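(* Let $\mathscr{A}$ be a Banach algebra and $\eta$ an infinite cardinal number. Suppose that $\mathscr{A}$ contains two bounded subsets $A=\{a_\alpha:\alpha\in\Lambda_1\}$ and $B=\{b_\beta:\beta\in\Lambda_2\}$ indexed, respectively, by two cofinal subsets $\Lambda_1$ and $\Lambda_2$ of a common directed set $(\Lambda,\preceq)$ with $\mathrm{tr}|\Lambda_1|=\mathrm{tr}|\Lambda_2|=\eta$. Suppose as well that $\mathscr{A}$ contains two other disjoint sets $X_1$ and $X_2$ with the following properties: (i) $X=X_1\cup X_2$ is an $\ell^1(\eta)$-base in $\mathscr{A}$ with constant $K>0$, contained in the ball of radius $M>0$. (ii) $X_1$ and $X_2$ approximate segments in $T^u_{AB}$ and $T^l_{AB}$, respectively. (iii) Either $X_1$ is vertically injective and $X_2$ is horizontally injective, or vice versa (with respect to the double-indexings of $X_1$, $X_2$ used in (ii)). Then there is a linear isomorphism (into) $\mathcal{J}\colon \ell^\infty(\eta)\to \langle X\rangle^*/\big(\mathscr{WAP}(\mathscr{A})|_{\langle X\rangle}\big)$, i.e. a linear map $\mathcal J$ for which there are constants $K_1,K_2>0$ with $K_1\|\mathbf c\|_\infty\le\|\mathcal J\mathbf c\|\le K_2\|\mathbf c\|_\infty$ for all $\mathbf c\in\ell^\infty(\eta)$. In particular, $\mathscr{A}$ is non-Arens regular.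
   Context: $\mathscr{A}^*$ is the Banach dual of $\mathscr{A}$. For $f\in\mathscr{A}^*$, $\varphi\in\mathscr{A}$, $f\varphi\in\mathscr{A}^*$ is given by $\langle f\varphi,\psi\rangle=\langle f,\varphi\psi\rangle$. $\mathscr{WAP}(\mathscr{A})$ (weakly almost periodic functionals) is the closed subspace of all $f\in\mathscr{A}^*$ such that $\{f\varphi:\varphi\in\mathscr{A},\|\varphi\|\le 1\}$ is relatively weakly compact in $\mathscr{A}^*$. $\mathscr{A}$ is Arens regular if the two Arens products on $\mathscr{A}^{**}$ coincide; by a theorem of Pym this holds iff $\mathscr{WAP}(\mathscr{A})=\mathscr{A}^*$. $\langle X\rangle$ is the linear span of $X$, with the norm of $\mathscr{A}$; $\mathscr{WAP}(\mathscr{A})|_{\langle X\rangle}=\{f|_{\langle X\rangle}: f\in\mathscr{WAP}(\mathscr{A})\}$, and the quotient carries the quotient (semi)norm. $\ell^1(\eta)$-base: a bounded set $B=\{a_\alpha:\alpha<\eta\}$ of cardinality $\eta$ ($\eta$ an infinite cardinal) in a normed space is an $\ell^1(\eta)$-base with constant $K>0$ if $\sum_{n=1}^p|z_n|\le K\|\sum_{n=1}^p z_na_{\alpha_n}\|$ for all $p\in\mathbb{N}$, all scalars $z_1,\dots,z_p$ and all distinct elements $a_{\alpha_1},\dots,a_{\alpha_p}$ of $B$. A directed set is a set with a preorder $\preceq$ in which every pair of elements has an upper bound; $\alpha\prec\beta$ means $\alpha\preceq\beta$ and $\alpha\ne\beta$. For a directed set $\Lambda$ and $\xi\in\Lambda$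 put $\xi^+=\{\alpha\in\Lambda:\xi\prec\alpha\}$; the true cardinality is $\mathrm{tr}|\Lambda|=\min_{\xi\in\Lambda}|\xi^+|$. Cofinal subsets are directed by the induced preorder. A set $X$ is indexed by a set $\mathcal U$ if there is a surjection $\mathcal U\to X$; if $\mathcal U\subseteq\Lambda\times\Lambda$ we say $X$ is double-indexed by $\mathcal U$ and write $X=\{x_{\alpha\beta}:(\alpha,\beta)\in\mathcal U\}$. It is vertically injective if $x_{\alpha\beta}=x_{\alpha'\beta'}$ implies $\beta=\beta'$, and horizontally injective if $x_{\alpha\beta}=x_{\alpha'\beta'}$ implies $\alpha=\alpha'$. $\mathcal U\subseteq\Lambda_1\times\Lambda_2$ is vertically cofinal if for every $\alpha\in\Lambda_1$ there is $\beta_\alpha\in\Lambda_2$ with $(\alpha,\beta)\in\mathcal U$ for every $\beta\in\Lambda_2$, $\beta\succeq\beta_\alpha$; it is horizontally cofinal if for every $\beta\in\Lambda_2$ there is $\alpha_\beta\in\Lambda_1$ with $(\alpha,\beta)\in\mathcal U$ for every $\alpha\in\Lambda_1$, $\alpha\succeq\alpha_\beta$. The upper and lower triangles are $T^u_{AB}=\{a_\alpha b_\beta:(\alpha,\beta)\in\Lambda_1\times\Lambda_2,\alpha\prec\beta\}$ and $T^l_{AB}=\{a_\alpha b_\beta:(\alpha,\beta)\in\Lambda_1\times\Lambda_2,\beta\prec\alpha\}$. A set $X\subseteq\mathscr{A}$ approximates segments in $T^u_{AB}$ if it can be double-indexed as $X=\{x_{\alpha\beta}:(\alpha,\beta)\in\mathcal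 U\}$ by a vertically cofinal $\mathcal U\subseteq\Lambda_1\times\Lambda_2$ so that for each $\alpha\in\Lambda_1$, $\lim_{\beta\in\Lambda_2}\|x_{\alpha\beta}-a_\alpha b_\beta\|=0$. It approximates segments in $T^l_{AB}$ if it can be double-indexed as $X=\{x_{\alpha\beta}:(\alpha,\beta)\in\mathcal U\}$ by a horizontally cofinal $\mathcal U\subseteq\Lambda_1\times\Lambda_2$ so that for each $\beta\in\Lambda_2$, $\lim_{\alpha\in\Lambda_1}\|x_{\alpha\beta}-a_\alpha b_\beta\|=0$. (One may assume that $(\alpha,\beta)\in\mathcal U$ implies $\alpha\prec\beta$, respectively $\beta\prec\alpha$.) *)

theory Defs
  imports "HOL-Analysis.Analysis" "HOL-Library.Function_Algebras"
begin

section \<open>Banach algebras over the real or the complex numbers\<close>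

text \<open>The normed fields that are isometrically isomorphic to the real or to the complex numbers.\<close>

class real_or_complex_field = real_normed_field +
  assumes real_or_complex:
    "(\<forall>x. \<exists>s. x = s *\<^sub>R 1) \<or>
     (\<exists>i. i * i = - 1 \<and>
       (\<forall>x. \<exists>s t. x = s *\<^sub>R 1 + t *\<^sub>R i \<and> norm x = sqrt (s\<^sup>2 + t\<^sup>2)))"

instance real :: real_or_complex_field
  by standard auto

instance complex :: real_or_complex_field
proof
  have "\<exists>s t. x = s *\<^sub>R 1 + t *\<^sub>R \<i> \<and> cmod x = sqrt (s\<^sup>2 + t\<^sup>2)" for x
    by (rule exI[of _ "Re x"], rule exI[of _ "Im x"])
      (simp add: complex_eq_iff cmod_def)
  moreover have "\<i> * \<i> = - 1" by simp
  ultimately show "(\<forall>x::complex. \<exists>s. x = s *\<^sub>R 1) \<or>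
     (\<exists>i::complex. i * i = - 1 \<and>
       (\<forall>x. \<exists>s t. x = s *\<^sub>R 1 + t *\<^sub>R i \<and> cmod x = sqrt (s\<^sup>2 + t\<^sup>2)))"
    by blast
qed

text \<open>The multiplication, the norm, its submultiplicativity and completeness come from the type
  classes; the locale adds the scalar multiplication by the field \<open>'k\<close>.  No unit is assumed.\<close>

locale banach_algebra = vector_space smul
  for smul :: "'k::real_or_complex_field \<Rightarrow> 'a::{real_normed_algebra,banach} \<Rightarrow> 'a" +
  assumes scale_of_real: "smul (of_real t) x = t *\<^sub>R x"
    and norm_scale: "norm (smul c x) = norm c * norm x"
    and mult_scale_left: "smul c x * y = smul c (x * y)"
    and mult_scale_right: "x * smul c y = smul c (x * y)"

lemma banach_algebra_real:
  "banach_algebra ((*\<^sub>R) :: real \<Rightarrow> 'a::{real_normed_algebra,banach} \<Rightarrow> 'a)"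
  by unfold_locales (simp_all add: algebra_simps)

lemma banach_algebra_complex: "banach_algebra ((*) :: complex \<Rightarrow> complex \<Rightarrow> complex)"
  by unfold_locales (simp_all add: algebra_simps norm_mult scaleR_conv_of_real)

section \<open>Dual spaces\<close>

text \<open>A normed space is given by a scalar multiplication, a carrier \<open>S\<close> (a linear subspace) and a
  norm \<open>N\<close> on \<open>S\<close>.  Functionals on \<open>S\<close> are total functions, made unique by being \<open>0\<close> outside \<open>S\<close>;
  the linear structure on them is the pointwise one.\<close>

definition restrict0 :: "'v set \<Rightarrow> ('v \<Rightarrow> 'k) \<Rightarrow> 'v \<Rightarrow> 'k::zero" where
  "restrict0 S f = (\<lambda>v. if v \<in> S then f v else 0)"

definition fun_scale :: "'k \<Rightarrow> ('v \<Rightarrow> 'k) \<Rightarrow> 'v \<Rightarrow> 'k::times" where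
  "fun_scale c f = (\<lambda>v. c * f v)"

definition dual_space ::
    "('k \<Rightarrow> 'v \<Rightarrow> 'v) \<Rightarrow> 'v set \<Rightarrow> ('v \<Rightarrow> real) \<Rightarrow> ('v::ab_group_add \<Rightarrow> 'k::real_normed_field) set" where
  "dual_space smul S N =
    {f. (\<forall>u\<in>S. \<forall>v\<in>S. f (u + v) = f u + f v) \<and>
        (\<forall>c. \<forall>v\<in>S. f (smul c v) = c * f v) \<and>
        (\<exists>C. \<forall>v\<in>S. norm (f v) \<le> C * N v) \<and>
        (\<forall>v. v \<notin> S \<longrightarrow> f v = 0)}"

definition dual_norm :: "'v set \<Rightarrow> ('v \<Rightarrow> real) \<Rightarrow> ('v \<Rightarrow> 'k::real_normed_field) \<Rightarrow> real" where
  "dual_norm S N f = (SUP v\<in>{v \<in> S. N v \<le> 1}. norm (f v))"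

definition weak_topology ::
    "('k::real_normed_field \<Rightarrow> 'v \<Rightarrow> 'v) \<Rightarrow> 'v set \<Rightarrow> ('v \<Rightarrow> real) \<Rightarrow> ('v::ab_group_add) topology" where
  "weak_topology smul S N = topology_generated_by
    {{v \<in> S. F v \<in> V} | F V. F \<in> dual_space smul S N \<and> open V}"

definition banach_dual ::
    "('k \<Rightarrow> 'a \<Rightarrow> 'a) \<Rightarrow> ('a::real_normed_vector \<Rightarrow> 'k::real_normed_field) set" where
  "banach_dual smul = dual_space smul UNIV norm"

definition banach_bidual ::
    "('k \<Rightarrow> 'a \<Rightarrow> 'a) \<Rightarrow> (('a::real_normed_vector \<Rightarrow> 'k) \<Rightarrow> 'k::real_normed_field) set" where
  "banach_bidual smul = dual_space fun_scale (banach_dual smul) (dual_norm UNIV norm)"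

section \<open>Weakly almost periodic functionals and Arens regularity\<close>

text \<open>\<open>fact_r f \<phi>\<close> is \<open>f\<phi>\<close> and \<open>fact_l \<phi> f\<close> is \<open>\<phi>f\<close>.\<close>

definition fact_r :: "('a::times \<Rightarrow> 'k) \<Rightarrow> 'a \<Rightarrow> 'a \<Rightarrow> 'k" where
  "fact_r f \<phi> = (\<lambda>\<psi>. f (\<phi> * \<psi>))"

definition fact_l :: "'a::times \<Rightarrow> ('a \<Rightarrow> 'k) \<Rightarrow> 'a \<Rightarrow> 'k" where
  "fact_l \<phi> f = (\<lambda>\<psi>. f (\<psi> * \<phi>))"

definition WAP ::
    "('k \<Rightarrow> 'a \<Rightarrow> 'a) \<Rightarrow> ('a::real_normed_algebra \<Rightarrow> 'k::real_normed_field) set" where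
  "WAP smul = {f \<in> banach_dual smul.
    let \<sigma> = weak_topology fun_scale (banach_dual smul) (dual_norm UNIV norm)
    in compactin \<sigma> (\<sigma> closure_of {fact_r f \<phi> | \<phi>. norm \<phi> \<le> 1})}"

text \<open>First Arens product: \<open>\<langle>m \<box> n, f\<rangle> = \<langle>m, n f\<rangle>\<close> with \<open>\<langle>n f, \<phi>\<rangle> = \<langle>n, f \<phi>\<rangle>\<close>.
  Second Arens product: \<open>\<langle>m \<diamond> n, f\<rangle> = \<langle>n, f m\<rangle>\<close> with \<open>\<langle>f m, \<phi>\<rangle> = \<langle>m, \<phi> f\<rangle>\<close>.\<close>

definition arens_first ::
    "('k \<Rightarrow> 'a \<Rightarrow> 'a) \<Rightarrow> (('a \<Rightarrow> 'k) \<Rightarrow> 'k) \<Rightarrow> (('a \<Rightarrow> 'k) \<Rightarrow> 'k) \<Rightarrow>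
     ('a::real_normed_algebra \<Rightarrow> 'k) \<Rightarrow> 'k::real_normed_field" where
  "arens_first smul m n = restrict0 (banach_dual smul) (\<lambda>f. m (\<lambda>\<phi>. n (fact_r f \<phi>)))"

definition arens_second ::
    "('k \<Rightarrow> 'a \<Rightarrow> 'a) \<Rightarrow> (('a \<Rightarrow> 'k) \<Rightarrow> 'k) \<Rightarrow> (('a \<Rightarrow> 'k) \<Rightarrow> 'k) \<Rightarrow>
     ('a::real_normed_algebra \<Rightarrow> 'k) \<Rightarrow> 'k::real_normed_field" where
  "arens_second smul m n = restrict0 (banach_dual smul) (\<lambda>f. n (\<lambda>\<phi>. m (fact_l \<phi> f)))"

definition arens_regular ::
    "('k::real_normed_field \<Rightarrow> 'a::real_normed_algebra \<Rightarrow> 'a) \<Rightarrow> bool" where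
  "arens_regular smul \<longleftrightarrow>
    (\<forall>m\<in>banach_bidual smul. \<forall>n\<in>banach_bidual smul. arens_first smul m n = arens_second smul m n)"

section \<open>The spaces \<open>\<langle>X\<rangle>\<^sup>*\<close>, \<open>WAP\<close> restricted to \<open>\<langle>X\<rangle>\<close>, and their quotient\<close>

definition span_dual ::
    "('k \<Rightarrow> 'a \<Rightarrow> 'a) \<Rightarrow> 'a set \<Rightarrow> ('a::real_normed_vector \<Rightarrow> 'k::real_normed_field) set" where
  "span_dual smul X = dual_space smul (module.span smul X) norm"

definition WAP_on_span ::
    "('k \<Rightarrow> 'a \<Rightarrow> 'a) \<Rightarrow> 'a set \<Rightarrow> ('a::real_normed_algebra \<Rightarrow> 'k::real_normed_field) set" where
  "WAP_on_span smul X = restrict0 (module.span smul X) ` WAP smul"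

definition quot_carrier :: "('v \<Rightarrow> 'k::plus) set \<Rightarrow> ('v \<Rightarrow> 'k) set \<Rightarrow> ('v \<Rightarrow> 'k) set set" where
  "quot_carrier V W = {{h + w | w. w \<in> W} | h. h \<in> V}"

definition quot_add :: "('v \<Rightarrow> 'k::plus) set \<Rightarrow> ('v \<Rightarrow> 'k) set \<Rightarrow> ('v \<Rightarrow> 'k) set" where
  "quot_add P Q = {f + g | f g. f \<in> P \<and> g \<in> Q}"

text \<open>The summand from \<open>W\<close> matters only for \<open>c = 0\<close>, where the result is the coset \<open>W\<close>.\<close>

definition quot_scale ::
    "('v \<Rightarrow> 'k) set \<Rightarrow> 'k \<Rightarrow> ('v \<Rightarrow> 'k) set \<Rightarrow> ('v \<Rightarrow> 'k::{plus,times}) set" where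
  "quot_scale W c Q = {fun_scale c f + w | f w. f \<in> Q \<and> w \<in> W}"

definition quot_norm :: "(('v \<Rightarrow> 'k) \<Rightarrow> real) \<Rightarrow> ('v \<Rightarrow> 'k) set \<Rightarrow> real" where
  "quot_norm N Q = (INF f\<in>Q. N f)"

section \<open>\<open>\<ell>\<^sup>\<infinity>(\<eta>)\<close> and \<open>\<ell>\<^sup>1(\<eta>)\<close>-bases\<close>

text \<open>A cardinal is a relation satisfying \<^const>\<open>Card_order\<close>; its field serves as index set.\<close>

definition linfty :: "'e rel \<Rightarrow> ('e \<Rightarrow> 'k::real_normed_field) set" where
  "linfty \<eta> = {c. bounded (c ` Field \<eta>) \<and> (\<forall>e. e \<notin> Field \<eta> \<longrightarrow> c e = 0)}"

definition linfty_norm :: "'e rel \<Rightarrow> ('e \<Rightarrow> 'k::real_normed_field) \<Rightarrow> real" where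
  "linfty_norm \<eta> c = (SUP e\<in>Field \<eta>. norm (c e))"

definition l1_base ::
    "('k::real_normed_field \<Rightarrow> 'a \<Rightarrow> 'a) \<Rightarrow> 'e rel \<Rightarrow> real \<Rightarrow> 'a::real_normed_vector set \<Rightarrow> bool" where
  "l1_base smul \<eta> K B \<longleftrightarrow>
    bounded B \<and> (card_of B, \<eta>) \<in> ordIso \<and> K > 0 \<and>
    (\<forall>(p::nat) z y. inj_on y {1..p} \<and> y ` {1..p} \<subseteq> B \<longrightarrow>
      (\<Sum>n=1..p. norm (z n)) \<le> K * norm (\<Sum>n=1..p. smul (z n) (y n)))"

section \<open>Directed sets and double indexing\<close>

text \<open>\<open>(\<alpha>, \<beta>) \<in> r\<close> means \<open>\<alpha> \<preceq> \<beta>\<close>.  Antisymmetry is not required.\<close>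

definition directed_set :: "'i set \<Rightarrow> 'i rel \<Rightarrow> bool" where
  "directed_set \<Lambda> r \<longleftrightarrow> preorder_on \<Lambda> r \<and>
    (\<forall>\<alpha>\<in>\<Lambda>. \<forall>\<beta>\<in>\<Lambda>. \<exists>\<gamma>\<in>\<Lambda>. (\<alpha>, \<gamma>) \<in> r \<and> (\<beta>, \<gamma>) \<in> r)"

definition cofinal_in :: "'i rel \<Rightarrow> 'i set \<Rightarrow> 'i set \<Rightarrow> bool" where
  "cofinal_in r \<Lambda> C \<longleftrightarrow> C \<subseteq> \<Lambda> \<and> (\<forall>\<alpha>\<in>\<Lambda>. \<exists>\<beta>\<in>C. (\<alpha>, \<beta>) \<in> r)"

definition strict_above :: "'i rel \<Rightarrow> 'i set \<Rightarrow> 'i \<Rightarrow> 'i set" where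
  "strict_above r \<Lambda> \<xi> = {\<alpha> \<in> \<Lambda>. (\<xi>, \<alpha>) \<in> r \<and> \<xi> \<noteq> \<alpha>}"

text \<open>\<open>\<eta> = tr|\<Lambda>|\<close>, the minimum of the cardinals of the sets \<open>\<xi>\<^sup>+\<close>.\<close>

definition is_true_cardinality :: "'i rel \<Rightarrow> 'i set \<Rightarrow> 'e rel \<Rightarrow> bool" where
  "is_true_cardinality r \<Lambda> \<eta> \<longleftrightarrow>
    (\<exists>\<xi>\<in>\<Lambda>. (card_of (strict_above r \<Lambda> \<xi>), \<eta>) \<in> ordIso) \<and>
    (\<forall>\<xi>\<in>\<Lambda>. (\<eta>, card_of (strict_above r \<Lambda> \<xi>)) \<in> ordLeq)"

definition net_filter :: "'i rel \<Rightarrow> 'i set \<Rightarrow> 'i filter" where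
  "net_filter r \<Lambda> = (INF \<xi>\<in>\<Lambda>. principal {\<alpha> \<in> \<Lambda>. (\<xi>, \<alpha>) \<in> r})"

lemma eventually_net_filter:
  assumes "\<Lambda> \<noteq> {}" and "trans r"
    and "\<And>\<alpha> \<beta>. \<alpha> \<in> \<Lambda> \<Longrightarrow> \<beta> \<in> \<Lambda> \<Longrightarrow> \<exists>\<gamma>\<in>\<Lambda>. (\<alpha>, \<gamma>) \<in> r \<and> (\<beta>, \<gamma>) \<in> r"
  shows "eventually P (net_filter r \<Lambda>) \<longleftrightarrow> (\<exists>\<xi>\<in>\<Lambda>. \<forall>\<alpha>\<in>\<Lambda>. (\<xi>, \<alpha>) \<in> r \<longrightarrow> P \<alpha>)"
proof -
  have "\<exists>x\<in>\<Lambda>. principal {\<alpha> \<in> \<Lambda>. (x, \<alpha>) \<in> r}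
      \<le> inf (principal {\<alpha> \<in> \<Lambda>. (a, \<alpha>) \<in> r}) (principal {\<alpha> \<in> \<Lambda>. (b, \<alpha>) \<in> r})"
    if ab: "a \<in> \<Lambda>" "b \<in> \<Lambda>" for a b
  proof -
    obtain c where "c \<in> \<Lambda>" "(a, c) \<in> r" "(b, c) \<in> r"
      using assms(3)[OF ab] by blast
    then have "{\<alpha> \<in> \<Lambda>. (c, \<alpha>) \<in> r} \<subseteq> {\<alpha> \<in> \<Lambda>. (a, \<alpha>) \<in> r} \<inter> {\<alpha> \<in> \<Lambda>. (b, \<alpha>) \<in> r}"
      using \<open>trans r\<close> by (auto dest: transD)
    then show ?thesis
      using \<open>c \<in> \<Lambda>\<close> by (auto simp: inf_principal)
  qed
  then show ?thesis
    unfolding net_filter_def using assms(1)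
    by (subst eventually_INF_base) (auto simp: eventually_principal)
qed

definition vertically_cofinal :: "'i rel \<Rightarrow> 'i set \<Rightarrow> 'i set \<Rightarrow> ('i \<times> 'i) set \<Rightarrow> bool" where
  "vertically_cofinal r \<Lambda>1 \<Lambda>2 U \<longleftrightarrow> U \<subseteq> \<Lambda>1 \<times> \<Lambda>2 \<and>
    (\<forall>\<alpha>\<in>\<Lambda>1. \<exists>\<beta>0\<in>\<Lambda>2. \<forall>\<beta>\<in>\<Lambda>2. (\<beta>0, \<beta>) \<in> r \<longrightarrow> (\<alpha>, \<beta>) \<in> U)"

definition horizontally_cofinal :: "'i rel \<Rightarrow> 'i set \<Rightarrow> 'i set \<Rightarrow> ('i \<times> 'i) set \<Rightarrow> bool" where
  "horizontally_cofinal r \<Lambda>1 \<Lambda>2 U \<longleftrightarrow> U \<subseteq> \<Lambda>1 \<times> \<Lambda>2 \<and>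
    (\<forall>\<beta>\<in>\<Lambda>2. \<exists>\<alpha>0\<in>\<Lambda>1. \<forall>\<alpha>\<in>\<Lambda>1. (\<alpha>0, \<alpha>) \<in> r \<longrightarrow> (\<alpha>, \<beta>) \<in> U)"

text \<open>In the next two definitions the values of \<open>x\<close> outside \<open>U\<close> are irrelevant: for fixed \<open>\<alpha>\<close>
  (respectively \<open>\<beta>\<close>) the index \<open>(\<alpha>, \<beta>)\<close> eventually lies in \<open>U\<close>.\<close>

definition approximates_upper_by :: "'i rel \<Rightarrow> 'i set \<Rightarrow> 'i set \<Rightarrow> ('i \<Rightarrow> 'a) \<Rightarrow> ('i \<Rightarrow> 'a) \<Rightarrow>
    'a::real_normed_algebra set \<Rightarrow> ('i \<times> 'i) set \<Rightarrow> ('i \<Rightarrow> 'i \<Rightarrow> 'a) \<Rightarrow> bool" where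
  "approximates_upper_by r \<Lambda>1 \<Lambda>2 a b X U x \<longleftrightarrow>
    vertically_cofinal r \<Lambda>1 \<Lambda>2 U \<and> X = {x \<alpha> \<beta> | \<alpha> \<beta>. (\<alpha>, \<beta>) \<in> U} \<and>
    (\<forall>\<alpha>\<in>\<Lambda>1. ((\<lambda>\<beta>. norm (x \<alpha> \<beta> - a \<alpha> * b \<beta>)) \<longlongrightarrow> 0) (net_filter r \<Lambda>2))"

definition approximates_lower_by :: "'i rel \<Rightarrow> 'i set \<Rightarrow> 'i set \<Rightarrow> ('i \<Rightarrow> 'a) \<Rightarrow> ('i \<Rightarrow> 'a) \<Rightarrow>
    'a::real_normed_algebra set \<Rightarrow> ('i \<times> 'i) set \<Rightarrow> ('i \<Rightarrow> 'i \<Rightarrow> 'a) \<Rightarrow> bool" where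
  "approximates_lower_by r \<Lambda>1 \<Lambda>2 a b X U x \<longleftrightarrow>
    horizontally_cofinal r \<Lambda>1 \<Lambda>2 U \<and> X = {x \<alpha> \<beta> | \<alpha> \<beta>. (\<alpha>, \<beta>) \<in> U} \<and>
    (\<forall>\<beta>\<in>\<Lambda>2. ((\<lambda>\<alpha>. norm (x \<alpha> \<beta> - a \<alpha> * b \<beta>)) \<longlongrightarrow> 0) (net_filter r \<Lambda>1))"

definition vertically_injective :: "('i \<times> 'i) set \<Rightarrow> ('i \<Rightarrow> 'i \<Rightarrow> 'a) \<Rightarrow> bool" where
  "vertically_injective U x \<longleftrightarrow>
    (\<forall>\<alpha> \<beta> \<alpha>' \<beta>'. (\<alpha>, \<beta>) \<in> U \<and> (\<alpha>', \<beta>') \<in> U \<and> x \<alpha> \<beta> = x \<alpha>' \<beta>' \<longrightarrow> \<beta> = \<beta>')"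

definition horizontally_injective :: "('i \<times> 'i) set \<Rightarrow> ('i \<Rightarrow> 'i \<Rightarrow> 'a) \<Rightarrow> bool" where
  "horizontally_injective U x \<longleftrightarrow>
    (\<forall>\<alpha> \<beta> \<alpha>' \<beta>'. (\<alpha>, \<beta>) \<in> U \<and> (\<alpha>', \<beta>') \<in> U \<and> x \<alpha> \<beta> = x \<alpha>' \<beta>' \<longrightarrow> \<alpha> = \<alpha>')"

end

theory Submission
  imports Defs
begin

text \<open>Split \<open>\<Lambda>1\<close> and \<open>\<Lambda>2\<close> into cofinal fibres indexed by \<open>\<eta>\<close>.  The injectivity of the double indexings
  lets us colour \<open>X\<close> accordingly, and \<open>c \<in> \<ell>\<^sup>\<infinity>(\<eta>)\<close> is sent to the coset of the functional \<open>\<Phi> c\<close> that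
  takes the value \<open>c e\<close> on the part of \<open>X1\<close> of colour \<open>e\<close> and \<open>- c e\<close> on that of \<open>X2\<close>; it is bounded
  because \<open>X\<close> is an \<open>\<ell>\<^sup>1\<close>-base.  Take limits along ultrafilters containing the fibres over \<open>e\<close>.
  For a weakly almost periodic \<open>f\<close> the two iterated limits of \<open>f (a \<alpha> * b \<beta>)\<close> have a common value \<open>L\<close>,
  and the values of \<open>\<Phi> c + f\<close> on \<open>X1\<close> and \<open>X2\<close> tend to \<open>c e + L\<close> and \<open>- c e + L\<close>, so that
  \<open>\<bar>c e\<bar> \<le> M * \<parallel>\<Phi> c + f\<parallel>\<close>.  Arens regularity would make the iterated limits agree for every
  functional on the algebra, in particular for a Hahn-Banach extension of \<open>- \<Phi> 1\<close>, which
  is absurd.\<close>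

section \<open>Ultrafilters\<close>

text \<open>The products \<open>a \<alpha> * b \<beta>\<close> need not lie in the span of
  \<open>X\<close>, where \<open>\<Phi> c\<close> lives. Limits are therefore taken only of
  functionals on the whole algebra, and \<open>\<Phi> c\<close> enters through its values on the
  approximants, which have to be constant along the limits. This is why only pairs with
  \<open>p \<alpha> = q \<beta> = e\<close> are tested and why the fibres must be cofinal. An
  element of \<open>X\<close> may carry several double indices; on such pairs both coordinates have
  the same colour, so injectivity in either direction makes the colour of the element well defined.
  Vertical cofinality controls \<open>X1\<close> for fixed \<open>\<alpha>\<close>, horizontal
  cofinality controls \<open>X2\<close> for fixed \<open>\<beta>\<close>, so the two sets see the
  iterated limits in opposite orders. The constants of the isomorphism are \<open>1 / M\<close>,
  because the test vectors are elements of \<open>X\<close>, and \<open>K\<close>, which bounds the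
  coefficients of a vector by its norm. Along ultrafilters all bounded scalar families converge, so
  no subnets have to be chosen.\<close>

definition ultrafilter :: "'a filter \<Rightarrow> bool" where
  "ultrafilter F \<longleftrightarrow> F \<noteq> bot \<and> (\<forall>P. eventually P F \<or> eventually (\<lambda>x. \<not> P x) F)"

lemma ultrafilter_not_bot: "ultrafilter F \<Longrightarrow> F \<noteq> bot"
  by (simp add: ultrafilter_def)

lemma ultrafilter_not_eventually:
  "ultrafilter F \<Longrightarrow> \<not> eventually P F \<Longrightarrow> eventually (\<lambda>x. \<not> P x) F"
  by (auto simp: ultrafilter_def)

text \<open>Zorn's lemma for the reversed order, since finer filters are smaller. A minimal proper
  filter decides every \<open>P\<close>: refining it by \<open>P\<close> either gives the trivial
  filter, so that \<open>P\<close> eventually fails, or gives the same filter back.\<close>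

lemma ultrafilter_exists_le:
  assumes "F \<noteq> bot"
  obtains U where "ultrafilter U" and "U \<le> F"
proof -
  define A where "A = {G. G \<noteq> bot \<and> G \<le> F}"
  have "\<exists>m\<in>A. \<forall>a\<in>A. a \<le> m \<longrightarrow> a = m"
  proof (rule predicate_Zorn)
    show "partial_order_on A (relation_of (\<lambda>x y. y \<le> x) A)"
      by (rule partial_order_on_relation_ofI) auto
    fix C assume C: "C \<in> Chains (relation_of (\<lambda>x y. y \<le> x) A)"
    then have CA: "C \<subseteq> A" and chain: "\<And>a b. a \<in> C \<Longrightarrow> b \<in> C \<Longrightarrow> a \<le> b \<or> b \<le> a"
      by (auto simp: Chains_def relation_of_def)
    show "\<exists>u\<in>A. \<forall>a\<in>C. u \<le> a"
    proof (cases "C = {}")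
      case True
      then show ?thesis using assms by (auto simp: A_def)
    next
      case False
      \<comment> \<open>A chain is a filter base, so \<open>False\<close> could hold eventually for
        the infimum only if it did for a member.\<close>
      have "eventually P (Inf C) \<longleftrightarrow> (\<exists>b\<in>C. eventually P b)" for P
      proof (rule eventually_Inf_base)
        fix G H assume "G \<in> C" "H \<in> C"
        then show "\<exists>x\<in>C. x \<le> inf G H"
          using chain[of G H] by (metis inf.absorb1 inf.absorb2 order_refl)
      qed (use False in simp)
      then have "Inf C \<noteq> bot"
        using CA by (auto simp: trivial_limit_def A_def)
      moreover have "Inf C \<le> F"
        using False CA by (auto simp: A_def intro: Inf_lower2)
      ultimately show ?thesis
        by (auto simp: A_def intro!: bexI[of _ "Inf C"] Inf_lower)
    qed
  qed
  then obtain U where U: "U \<in> A" and min: "\<And>G. G \<in> A \<Longrightarrow> G \<le> U \<Longrightarrow> G = U"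
    by blast
  have "eventually P U \<or> eventually (\<lambda>x. \<not> P x) U" for P
  proof (cases "inf U (principal {x. P x}) = bot")
    case True
    then show ?thesis
      by (auto simp: trivial_limit_def eventually_inf_principal)
  next
    case False
    then have "inf U (principal {x. P x}) = U"
      using U by (intro min) (auto simp: A_def intro: le_infI1)
    then have "U \<le> principal {x. P x}"
      by (metis inf.cobounded2)
    then show ?thesis
      by (simp add: le_principal)
  qed
  then show ?thesis
    using U that by (auto simp: ultrafilter_def A_def)
qed

text \<open>If no point of \<open>C\<close> were a limit, each would have a neighbourhood that
  \<open>g\<close> does not eventually stay in, hence, along an ultrafilter, eventually avoids.
  Finitely many of these cover \<open>C\<close>, so \<open>g\<close> would eventually avoid
  \<open>C\<close>.\<close>

lemma ultrafilter_limitin_compactin: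
  assumes U: "ultrafilter U" and C: "compactin X C" and ev: "\<forall>\<^sub>F i in U. g i \<in> C"
  shows "\<exists>l\<in>C. limitin X g l U"
proof (rule ccontr)
  assume "\<not> (\<exists>l\<in>C. limitin X g l U)"
  then have no: "\<not> limitin X g l U" if "l \<in> C" for l
    using that by blast
  have "\<exists>N. openin X N \<and> l \<in> N \<and> \<not> (\<forall>\<^sub>F i in U. g i \<in> N)" if "l \<in> C" for l
    using no[OF that] compactin_subset_topspace[OF C] that by (auto simp: limitin_def)
  then obtain N where N: "\<And>l. l \<in> C \<Longrightarrow> openin X (N l) \<and> l \<in> N l \<and> \<not> (\<forall>\<^sub>F i in U. g i \<in> N l)"
    by metis
  then have "\<forall>W\<in>N ` C. openin X W" "C \<subseteq> \<Union>(N ` C)"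
    by auto
  with C obtain \<F> where \<F>: "finite \<F>" "\<F> \<subseteq> N ` C" "C \<subseteq> \<Union>\<F>"
    unfolding compactin_def by meson
  have "\<forall>\<^sub>F i in U. g i \<notin> W" if "W \<in> \<F>" for W
    using that \<F>(2) N ultrafilter_not_eventually[OF U] by blast
  then have "\<forall>\<^sub>F i in U. \<forall>W\<in>\<F>. g i \<notin> W"
    using \<F>(1) by (simp add: eventually_ball_finite)
  with ev have "\<forall>\<^sub>F i in U. False"
    by eventually_elim (use \<F>(3) in blast)
  then show False
    using ultrafilter_not_bot[OF U] by simp
qed

text \<open>The field is known only through its real coordinates, so the ball is exhibited as a
  closed subset of a continuous image of a square in the plane. In the real case the second
  coordinate is idle.\<close>

lemma compact_real_or_complex_field_ball:
  "compact {z::'k::real_or_complex_field. norm z \<le> R}"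
proof -
  have closed: "closed {z::'k. norm z \<le> R}"
    by (intro closed_Collect_le continuous_intros)
  obtain h :: "real \<times> real \<Rightarrow> 'k" where h: "continuous_on UNIV h"
    and sub: "{z::'k. norm z \<le> R} \<subseteq> h ` ({- \<bar>R\<bar>..\<bar>R\<bar>} \<times> {- \<bar>R\<bar>..\<bar>R\<bar>})"
    using real_or_complex[where 'a='k]
  proof
    assume "\<forall>x::'k. \<exists>s. x = s *\<^sub>R 1"
    then have real: "\<exists>s. z = s *\<^sub>R 1" for z :: 'k
      by blast
    have "z \<in> (\<lambda>p. fst p *\<^sub>R (1::'k)) ` ({- \<bar>R\<bar>..\<bar>R\<bar>} \<times> {- \<bar>R\<bar>..\<bar>R\<bar>})"
      if "norm z \<le> R" for z
    proof -
      obtain s where "z = s *\<^sub>R 1"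
        using real by blast
      then show ?thesis
        using that by (intro image_eqI[of _ _ "(s, 0)"]) auto
    qed
    then show thesis
      by (intro that[of "\<lambda>p. fst p *\<^sub>R (1::'k)"]) (auto intro!: continuous_intros)
  next
    assume "\<exists>i::'k. i * i = - 1 \<and> (\<forall>x. \<exists>s t. x = s *\<^sub>R 1 + t *\<^sub>R i \<and> norm x = sqrt (s\<^sup>2 + t\<^sup>2))"
    then obtain i :: 'k where i: "\<And>x. \<exists>s t. x = s *\<^sub>R 1 + t *\<^sub>R i \<and> norm x = sqrt (s\<^sup>2 + t\<^sup>2)"
      by blast
    have "z \<in> (\<lambda>p. fst p *\<^sub>R 1 + snd p *\<^sub>R i) ` ({- \<bar>R\<bar>..\<bar>R\<bar>} \<times> {- \<bar>R\<bar>..\<bar>R\<bar>})"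
      if "norm z \<le> R" for z
    proof -
      obtain s t where st: "z = s *\<^sub>R 1 + t *\<^sub>R i" "norm z = sqrt (s\<^sup>2 + t\<^sup>2)"
        using i by blast
      have "\<bar>s\<bar> \<le> norm z" "\<bar>t\<bar> \<le> norm z"
        unfolding st(2) by (simp_all add: real_le_rsqrt)
      then show ?thesis
        using that by (intro image_eqI[of _ _ "(s, t)"]) (auto simp: st(1))
    qed
    then show thesis
      by (intro that[of "\<lambda>p. fst p *\<^sub>R 1 + snd p *\<^sub>R i"]) (auto intro!: continuous_intros)
  qed
  have "compact (h ` ({- \<bar>R\<bar>..\<bar>R\<bar>} \<times> {- \<bar>R\<bar>..\<bar>R\<bar>}))"
    by (intro compact_continuous_image continuous_on_subset[OF h] compact_Times) auto
  then have "compact (h ` ({- \<bar>R\<bar>..\<bar>R\<bar>} \<times> {- \<bar>R\<bar>..\<bar>R\<bar>}) \<inter> {z. norm z \<le> R})"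
    using closed by (rule compact_Int_closed)
  then show ?thesis
    using sub by (simp add: inf.absorb2)
qed

text \<open>This makes the total operator \<open>Lim\<close> a genuine limit for bounded families,
  which is what allows iterated limits to be written as terms.\<close>

lemma ultrafilter_tendsto_Lim:
  fixes g :: "'i \<Rightarrow> 'k::real_or_complex_field"
  assumes U: "ultrafilter U" and ev: "\<forall>\<^sub>F i in U. norm (g i) \<le> R"
  shows "(g \<longlongrightarrow> Lim U g) U"
proof -
  have "compactin euclidean {z::'k. norm z \<le> R}"
    using compact_real_or_complex_field_ball by simp
  from ultrafilter_limitin_compactin[OF U this, of g] ev
  obtain l where "limitin euclidean g l U"
    by auto
  then show ?thesis
    using tendsto_Lim[of U g l] ultrafilter_not_bot[OF U] by auto
qed

lemma Lim_eqI: "ultrafilter U \<Longrightarrow> (g \<longlongrightarrow> l) U \<Longrightarrow> Lim U g = l"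
  by (rule tendsto_Lim) (auto simp: ultrafilter_def)

lemma norm_Lim_le:
  fixes g :: "'i \<Rightarrow> 'k::real_or_complex_field"
  assumes U: "ultrafilter U" and ev: "\<forall>\<^sub>F i in U. norm (g i) \<le> R"
  shows "norm (Lim U g) \<le> R"
  using ultrafilter_not_bot[OF U] ultrafilter_tendsto_Lim[OF U ev] ev
  by (rule Lim_norm_ubound)

section \<open>Directed sets of a given true cardinality\<close>

text \<open>Transfinite recursion along a cardinal well-order of \<open>I\<close>: at stage
  \<open>i\<close> fewer than \<open>|I|\<close> values have been used, and \<open>T i\<close> has
  at least \<open>|I|\<close> elements, so a fresh one is left.\<close>

lemma injective_choice:
  assumes I: "(card_of I, \<eta>) \<in> ordLeq" and T: "\<And>i. i \<in> I \<Longrightarrow> (\<eta>, card_of (T i)) \<in> ordLeq"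
  shows "\<exists>g. inj_on g I \<and> (\<forall>i\<in>I. g i \<in> T i)"
proof -
  let ?r = "card_of I"
  have wo: "Well_order ?r" and fld: "Field ?r = I" and card: "Card_order ?r"
    by (rule card_of_Well_order Field_card_of card_of_Card_order)+
  have "\<exists>g. \<forall>i. i \<in> I \<longrightarrow> g i \<in> T i \<and> g i \<notin> g ` underS ?r i"
  proof (rule dependent_wf_choice[where R = "?r - Id"])
    show "wf (?r - Id)"
      using wo by (simp add: well_order_on_def)
    show "(i \<in> I \<longrightarrow> x \<in> T i \<and> x \<notin> f ` underS ?r i) = (i \<in> I \<longrightarrow> x \<in> T i \<and> x \<notin> g ` underS ?r i)"
      if "\<And>z. (z, i) \<in> ?r - Id \<Longrightarrow> f z = g z" for f g i x
    proof -
      have "f ` underS ?r i = g ` underS ?r i"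
        using that by (intro image_cong) (auto simp: underS_def)
      then show ?thesis by simp
    qed
    fix i f
    show "\<exists>x. i \<in> I \<longrightarrow> x \<in> T i \<and> x \<notin> f ` underS ?r i"
    proof (cases "i \<in> I")
      case True
      then have "(card_of (underS ?r i), ?r) \<in> ordLess"
        using card_of_underS[OF card] fld by simp
      then have "(card_of (f ` underS ?r i), ?r) \<in> ordLess"
        by (rule ordLeq_ordLess_trans[OF card_of_image])
      moreover have "(?r, card_of (T i)) \<in> ordLeq"
        using I T[OF True] by (rule ordLeq_transitive)
      ultimately have "\<not> T i \<subseteq> f ` underS ?r i"
        using card_of_mono1 not_ordLess_ordLeq ordLess_ordLeq_trans by blast
      then show ?thesis by blast
    qed simp
  qed
  then obtain g where g: "\<And>i. i \<in> I \<Longrightarrow> g i \<in> T i \<and> g i \<notin> g ` underS ?r i"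
    by blast
  have tot: "i = j \<or> i \<in> underS ?r j \<or> j \<in> underS ?r i" if "i \<in> I" "j \<in> I" for i j
    using wo that fld unfolding well_order_on_def linear_order_on_def total_on_def underS_def by auto
  have "inj_on g I"
  proof (rule inj_onI)
    fix i j assume "i \<in> I" "j \<in> I" "g i = g j"
    then show "i = j"
      using tot[of i j] g[of i] g[of j] by (metis imageI)
  qed
  then show ?thesis
    using g by blast
qed

lemma directed_set_cofinal:
  assumes "directed_set \<Lambda> r" and "cofinal_in r \<Lambda> C" and "\<alpha> \<in> C" and "\<beta> \<in> C"
  shows "\<exists>\<gamma>\<in>C. (\<alpha>, \<gamma>) \<in> r \<and> (\<beta>, \<gamma>) \<in> r"
proof -
  have "trans r" "\<alpha> \<in> \<Lambda>" "\<beta> \<in> \<Lambda>"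
    using assms by (auto simp: directed_set_def cofinal_in_def preorder_on_def)
  obtain \<gamma> where "\<gamma> \<in> \<Lambda>" "(\<alpha>, \<gamma>) \<in> r" "(\<beta>, \<gamma>) \<in> r"
    using assms(1) \<open>\<alpha> \<in> \<Lambda>\<close> \<open>\<beta> \<in> \<Lambda>\<close> unfolding directed_set_def by blast
  moreover obtain \<delta> where "\<delta> \<in> C" "(\<gamma>, \<delta>) \<in> r"
    using assms(2) \<open>\<gamma> \<in> \<Lambda>\<close> unfolding cofinal_in_def by blast
  ultimately show ?thesis
    using \<open>trans r\<close> by (meson transD)
qed

text \<open>\<open>\<Lambda>\<close> itself may have more than \<open>\<eta>\<close> elements, but
  some tail \<open>D\<close> has exactly \<open>\<eta>\<close>, and \<open>D\<close> is still
  cofinal. It is enough to place, for each pair of \<open>\<delta> \<in> D\<close> and a colour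
  \<open>e\<close>, an element strictly above \<open>\<delta>\<close> into the fibre of
  \<open>e\<close>. These are at most \<open>\<eta>\<close> requirements, and every tail has at
  least \<open>\<eta>\<close> candidates, so they can be met by distinct elements, which are then
  coloured consistently.\<close>

lemma cofinal_fibres:
  assumes \<eta>: "Card_order \<eta>" "infinite (Field \<eta>)"
    and tr: "is_true_cardinality r \<Lambda> \<eta>" and "trans r"
    and dir: "\<And>\<alpha> \<beta>. \<alpha> \<in> \<Lambda> \<Longrightarrow> \<beta> \<in> \<Lambda> \<Longrightarrow> \<exists>\<gamma>\<in>\<Lambda>. (\<alpha>, \<gamma>) \<in> r \<and> (\<beta>, \<gamma>) \<in> r"
  obtains p where "\<And>\<gamma>. p \<gamma> \<in> Field \<eta>"
    and "\<And>\<xi> e. \<xi> \<in> \<Lambda> \<Longrightarrow> e \<in> Field \<eta> \<Longrightarrow> \<exists>\<gamma>\<in>\<Lambda>. (\<xi>, \<gamma>) \<in> r \<and> p \<gamma> = e"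
proof -
  obtain \<xi>0 where \<xi>0: "\<xi>0 \<in> \<Lambda>" "(card_of (strict_above r \<Lambda> \<xi>0), \<eta>) \<in> ordIso"
    using tr by (auto simp: is_true_cardinality_def)
  have above: "(\<eta>, card_of (strict_above r \<Lambda> \<xi>)) \<in> ordLeq" if "\<xi> \<in> \<Lambda>" for \<xi>
    using tr that by (auto simp: is_true_cardinality_def)
  define D where "D = strict_above r \<Lambda> \<xi>0"
  have D: "D \<subseteq> \<Lambda>"
    by (auto simp: D_def strict_above_def)
  have D_above: "\<exists>\<delta>\<in>D. (\<xi>, \<delta>) \<in> r" if \<xi>: "\<xi> \<in> \<Lambda>" for \<xi>
  proof -
    obtain \<beta> where \<beta>: "\<beta> \<in> \<Lambda>" "(\<xi>, \<beta>) \<in> r" "(\<xi>0, \<beta>) \<in> r"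
      using dir[OF \<xi> \<xi>0(1)] by blast
    have "infinite (strict_above r \<Lambda> \<beta>)"
      using above[OF \<beta>(1)] \<eta> by (metis card_of_Field_ordIso card_of_ordLeq_infinite ordIso_ordLeq_trans)
    \<comment> \<open>As \<open>r\<close> need not be antisymmetric, \<open>\<xi>0\<close> may itself lie strictly above \<open>\<beta>\<close>.\<close>
    then have "infinite (strict_above r \<Lambda> \<beta> - {\<xi>0})"
      by simp
    then obtain \<delta> where "\<delta> \<in> strict_above r \<Lambda> \<beta> - {\<xi>0}"
      by (metis ex_in_conv finite.emptyI)
    then show ?thesis
      using \<beta> \<open>trans r\<close> by (intro bexI[of _ \<delta>]) (auto simp: D_def strict_above_def dest: transD)
  qed
  have "(card_of (D \<times> Field \<eta>), \<eta>) \<in> ordLeq"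
    using \<xi>0(2) \<eta> by (intro card_of_Times_ordLeq_infinite_Field) (auto simp: D_def intro: ordIso_imp_ordLeq card_of_Field_ordIso)
  then have "\<exists>g. inj_on g (D \<times> Field \<eta>) \<and> (\<forall>i\<in>D \<times> Field \<eta>. g i \<in> strict_above r \<Lambda> (fst i))"
    by (rule injective_choice) (use D above in auto)
  then obtain g where g: "inj_on g (D \<times> Field \<eta>)"
    "\<And>i. i \<in> D \<times> Field \<eta> \<Longrightarrow> g i \<in> strict_above r \<Lambda> (fst i)"
    by blast
  obtain e0 where e0: "e0 \<in> Field \<eta>"
    using \<eta>(2) by (metis ex_in_conv finite.emptyI)
  \<comment> \<open>The default \<open>e0\<close> gives every index a colour in
    \<open>Field \<eta>\<close>; enlarging one fibre keeps it cofinal.\<close>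
  define p where "p \<gamma> = (if \<gamma> \<in> g ` (D \<times> Field \<eta>) then snd (inv_into (D \<times> Field \<eta>) g \<gamma>) else e0)" for \<gamma>
  show thesis
  proof (rule that)
    show "p \<gamma> \<in> Field \<eta>" for \<gamma>
    proof (cases "\<gamma> \<in> g ` (D \<times> Field \<eta>)")
      case True
      then show ?thesis
        using inv_into_into[OF True] by (auto simp: p_def mem_Times_iff)
    qed (simp add: p_def e0)
    fix \<xi> e assume "\<xi> \<in> \<Lambda>" and e: "e \<in> Field \<eta>"
    then obtain \<delta> where \<delta>: "\<delta> \<in> D" "(\<xi>, \<delta>) \<in> r"
      using D_above by blast
    with e have i: "(\<delta>, e) \<in> D \<times> Field \<eta>"
      by simp
    have "p (g (\<delta>, e)) = e"
      using i g(1) by (simp add: p_def inv_into_f_f[OF g(1) i])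
    moreover have "g (\<delta>, e) \<in> \<Lambda>" "(\<delta>, g (\<delta>, e)) \<in> r"
      using g(2)[OF i] by (auto simp: strict_above_def)
    ultimately show "\<exists>\<gamma>\<in>\<Lambda>. (\<xi>, \<gamma>) \<in> r \<and> p \<gamma> = e"
      using \<delta>(2) \<open>trans r\<close> by (meson transD)
  qed
qed

section \<open>Dual spaces\<close>

lemma dual_space_bounded:
  assumes "f \<in> dual_space smul S N"
  obtains C where "\<And>v. v \<in> S \<Longrightarrow> norm (f v) \<le> C * N v"
  using assms unfolding dual_space_def by blast

lemma dual_space_bdd_above:
  assumes "f \<in> dual_space smul S N" and "\<And>v. v \<in> S \<Longrightarrow> 0 \<le> N v"
  shows "bdd_above ((\<lambda>v. norm (f v)) ` {v \<in> S. N v \<le> 1})"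
proof -
  obtain C where C: "\<And>v. v \<in> S \<Longrightarrow> norm (f v) \<le> C * N v"
    using dual_space_bounded[OF assms(1)] by blast
  have "norm (f v) \<le> \<bar>C\<bar>" if "v \<in> S" "N v \<le> 1" for v
  proof -
    have "norm (f v) \<le> \<bar>C\<bar> * N v"
      using C[OF \<open>v \<in> S\<close>] mult_right_mono[OF abs_ge_self assms(2)[OF \<open>v \<in> S\<close>], of C] by linarith
    also have "\<dots> \<le> \<bar>C\<bar> * 1"
      using that by (intro mult_left_mono) auto
    finally show ?thesis by simp
  qed
  then show ?thesis
    by (auto intro!: bdd_aboveI2)
qed

lemma dual_norm_nonneg:
  assumes "f \<in> dual_space smul S norm" and "0 \<in> S"
  shows "0 \<le> dual_norm S norm f"
proof -
  have "norm (f 0) \<le> dual_norm S norm f"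
    unfolding dual_norm_def using assms(2)
    by (intro cSUP_upper dual_space_bdd_above[OF assms(1)]) auto
  then show ?thesis
    using norm_ge_zero order_trans by blast
qed

lemma dual_norm_le:
  assumes "\<And>v. v \<in> S \<Longrightarrow> norm (f v) \<le> C * norm v" and "0 \<le> C" and "0 \<in> S"
  shows "dual_norm S norm f \<le> C"
  unfolding dual_norm_def
proof (rule cSUP_least)
  show "{v \<in> S. norm v \<le> 1} \<noteq> {}"
    using assms(3) by force
  fix v assume "v \<in> {v \<in> S. norm v \<le> 1}"
  then have "norm (f v) \<le> C * norm v" "C * norm v \<le> C * 1"
    using assms(1,2) by (auto intro: mult_left_mono simp del: mult_1_right)
  then show "norm (f v) \<le> C" by simp
qed

lemma banach_dualI:
  assumes "\<And>u v. f (u + v) = f u + f v" and "\<And>c v. f (smul c v) = c * f v"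
    and "\<And>v. norm (f v) \<le> C * norm v"
  shows "f \<in> banach_dual smul"
  using assms by (auto simp: banach_dual_def dual_space_def)

lemma banach_dual_add: "f \<in> banach_dual smul \<Longrightarrow> f (u + v) = f u + f v"
  and banach_dual_scale: "f \<in> banach_dual smul \<Longrightarrow> f (smul c v) = c * f v"
  by (auto simp: banach_dual_def dual_space_def)

lemma banach_dual_diff: "f \<in> banach_dual smul \<Longrightarrow> f (u - v) = f u - f v"
  using banach_dual_add[of f smul "u - v" v] by simp

lemma banach_bidual_add:
    "m \<in> banach_bidual smul \<Longrightarrow> f \<in> banach_dual smul \<Longrightarrow> g \<in> banach_dual smul \<Longrightarrow> m (f + g) = m f + m g"
  and banach_bidual_scale:
    "m \<in> banach_bidual smul \<Longrightarrow> f \<in> banach_dual smul \<Longrightarrow> m (fun_scale c f) = c * m f"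
  and banach_bidual_bounded:
    "m \<in> banach_bidual smul \<Longrightarrow> \<exists>C. \<forall>f\<in>banach_dual smul. norm (m f) \<le> C * dual_norm UNIV norm f"
  by (auto simp: banach_bidual_def dual_space_def)

abbreviation dual_weak_topology where
  "dual_weak_topology smul \<equiv> weak_topology fun_scale (banach_dual smul) (dual_norm UNIV norm)"

context banach_algebra
begin

lemma dual_norm_bound:
  assumes f: "f \<in> dual_space smul S norm" and S: "subspace S" and v: "v \<in> S"
  shows "norm (f v) \<le> dual_norm S norm f * norm v"
proof (cases "v = 0")
  case True
  have "f (smul 0 v) = 0 * f v"
    using f v unfolding dual_space_def by blast
  then show ?thesis
    using True by simp
next
  case False
  define u where "u = smul (of_real (1 / norm v)) v"
  have u: "u \<in> S" "norm u \<le> 1"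
    using S v False by (auto simp: u_def subspace_scale norm_scale norm_divide)
  have "f u = of_real (1 / norm v) * f v"
    using f v unfolding u_def dual_space_def by blast
  then have "norm (f v) / norm v = norm (f u)"
    using False by (simp add: norm_mult norm_divide)
  also have "\<dots> \<le> dual_norm S norm f"
    unfolding dual_norm_def using u
    by (intro cSUP_upper dual_space_bdd_above[OF f]) auto
  finally show ?thesis
    using False by (simp add: field_simps)
qed

lemma banach_dual_bound:
  "f \<in> banach_dual smul \<Longrightarrow> norm (f v) \<le> dual_norm UNIV norm f * norm v"
  by (rule dual_norm_bound) (auto simp: banach_dual_def)

lemma banach_dual_norm_nonneg: "f \<in> banach_dual smul \<Longrightarrow> 0 \<le> dual_norm UNIV norm f"
  by (rule dual_norm_nonneg) (auto simp: banach_dual_def)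

lemma dual_space_zero: "0 \<in> dual_space smul' S N"
  by (auto simp: dual_space_def intro!: exI[of _ 0])

lemma dual_space_plus:
  assumes "f \<in> dual_space smul S norm" and "g \<in> dual_space smul S norm"
  shows "f + g \<in> dual_space smul S norm"
proof -
  obtain C D where "\<And>v. v \<in> S \<Longrightarrow> norm (f v) \<le> C * norm v" "\<And>v. v \<in> S \<Longrightarrow> norm (g v) \<le> D * norm v"
    using dual_space_bounded[OF assms(1)] dual_space_bounded[OF assms(2)] by metis
  then have "norm (f v + g v) \<le> (C + D) * norm v" if "v \<in> S" for v
    using that norm_triangle_ineq[of "f v" "g v"] by (fastforce simp: algebra_simps)
  then have "\<exists>C. \<forall>v\<in>S. norm (f v + g v) \<le> C * norm v"
    by blast
  then show ?thesis
    using assms by (auto simp: dual_space_def distrib_left)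
qed

lemma dual_space_scale:
  assumes "f \<in> dual_space smul S norm"
  shows "fun_scale c f \<in> dual_space smul S norm"
proof -
  obtain C where "\<And>v. v \<in> S \<Longrightarrow> norm (f v) \<le> C * norm v"
    using dual_space_bounded[OF assms] by blast
  then have "norm (c * f v) \<le> (norm c * C) * norm v" if "v \<in> S" for v
    using that by (simp add: norm_mult mult_left_mono mult.assoc)
  then have "\<exists>C. \<forall>v\<in>S. norm (c * f v) \<le> C * norm v"
    by blast
  then show ?thesis
    using assms by (auto simp: dual_space_def fun_scale_def distrib_left mult.left_commute)
qed

lemma banach_dual_plus: "f \<in> banach_dual smul \<Longrightarrow> g \<in> banach_dual smul \<Longrightarrow> f + g \<in> banach_dual smul"
  and banach_dual_fun_scale: "f \<in> banach_dual smul \<Longrightarrow> fun_scale c f \<in> banach_dual smul"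
  and banach_dual_zero: "0 \<in> banach_dual smul"
  unfolding banach_dual_def by (rule dual_space_plus dual_space_scale dual_space_zero; assumption)+

section \<open>The algebra acting on its dual, and the functionals that form the Arens
  products\<close>

lemma fact_bound:
  assumes f: "f \<in> banach_dual smul"
  shows "norm (f (u * v)) \<le> dual_norm UNIV norm f * norm u * norm v"
proof -
  have "norm (f (u * v)) \<le> dual_norm UNIV norm f * norm (u * v)"
    by (rule banach_dual_bound[OF f])
  also have "\<dots> \<le> dual_norm UNIV norm f * (norm u * norm v)"
    by (intro mult_left_mono norm_mult_ineq banach_dual_norm_nonneg[OF f])
  finally show ?thesis by (simp add: mult.assoc)
qed

lemma fact_r_dual:
  assumes f: "f \<in> banach_dual smul"
  shows "fact_r f \<phi> \<in> banach_dual smul"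
    and "dual_norm UNIV norm (fact_r f \<phi>) \<le> dual_norm UNIV norm f * norm \<phi>"
proof -
  have "norm (fact_r f \<phi> v) \<le> (dual_norm UNIV norm f * norm \<phi>) * norm v" for v
    using fact_bound[OF f] by (simp add: fact_r_def)
  then show "fact_r f \<phi> \<in> banach_dual smul"
    by (intro banach_dualI)
      (auto simp: fact_r_def distrib_left mult_scale_right banach_dual_add[OF f] banach_dual_scale[OF f])
  show "dual_norm UNIV norm (fact_r f \<phi>) \<le> dual_norm UNIV norm f * norm \<phi>"
    using fact_bound[OF f] by (intro dual_norm_le) (auto simp: fact_r_def banach_dual_norm_nonneg[OF f])
qed

lemma fact_l_dual:
  assumes f: "f \<in> banach_dual smul"
  shows "fact_l \<phi> f \<in> banach_dual smul"
    and "dual_norm UNIV norm (fact_l \<phi> f) \<le> dual_norm UNIV norm f * norm \<phi>"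
proof -
  have "norm (fact_l \<phi> f v) \<le> (dual_norm UNIV norm f * norm \<phi>) * norm v" for v
    using fact_bound[OF f, of v \<phi>] by (simp add: fact_l_def ac_simps)
  then show "fact_l \<phi> f \<in> banach_dual smul"
    and "dual_norm UNIV norm (fact_l \<phi> f) \<le> dual_norm UNIV norm f * norm \<phi>"
    by (auto intro!: banach_dualI dual_norm_le simp: banach_dual_norm_nonneg[OF f])
      (auto simp: fact_l_def distrib_right mult_scale_left banach_dual_add[OF f] banach_dual_scale[OF f])
qed

text \<open>These are the inner functionals of the two Arens products. Their membership in the dual
  ensures that a bidual element of the form \<open>restrict0 (banach_dual smul) _\<close> is
  evaluated on them rather than replaced by \<open>0\<close>.\<close>

lemma bidual_fact_dual:
  assumes f: "f \<in> banach_dual smul" and m: "m \<in> banach_bidual smul"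
  shows "(\<lambda>\<phi>. m (fact_r f \<phi>)) \<in> banach_dual smul" and "(\<lambda>\<phi>. m (fact_l \<phi> f)) \<in> banach_dual smul"
proof -
  obtain C where C: "\<And>g. g \<in> banach_dual smul \<Longrightarrow> norm (m g) \<le> C * dual_norm UNIV norm g"
    using banach_bidual_bounded[OF m] by blast
  have bound: "norm (m g) \<le> (\<bar>C\<bar> * D) * t"
    if g: "g \<in> banach_dual smul" and le: "dual_norm UNIV norm g \<le> D * t" for g D t
  proof -
    have "norm (m g) \<le> \<bar>C\<bar> * dual_norm UNIV norm g"
      using C[OF g] mult_right_mono[OF abs_ge_self banach_dual_norm_nonneg[OF g], of C] by linarith
    also have "\<dots> \<le> \<bar>C\<bar> * (D * t)"
      using le by (intro mult_left_mono) auto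
    finally show ?thesis by (simp add: mult.assoc)
  qed
  have r: "fact_r f (u + v) = fact_r f u + fact_r f v" "fact_r f (smul c v) = fun_scale c (fact_r f v)"
    and l: "fact_l (u + v) f = fact_l u f + fact_l v f" "fact_l (smul c v) f = fun_scale c (fact_l v f)"
    for u v c
    using f by (auto simp: fact_r_def fact_l_def fun_scale_def fun_eq_iff distrib_left distrib_right
        mult_scale_left mult_scale_right banach_dual_add banach_dual_scale)
  show "(\<lambda>\<phi>. m (fact_r f \<phi>)) \<in> banach_dual smul"
    by (rule banach_dualI)
      (auto simp: r banach_bidual_add[OF m] banach_bidual_scale[OF m] fact_r_dual[OF f]
        intro!: bound[OF fact_r_dual[OF f]])
  show "(\<lambda>\<phi>. m (fact_l \<phi> f)) \<in> banach_dual smul"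
    by (rule banach_dualI)
      (auto simp: l banach_bidual_add[OF m] banach_bidual_scale[OF m] fact_l_dual[OF f]
        intro!: bound[OF fact_l_dual[OF f]])
qed

section \<open>Bidual elements from bounded families and from points\<close>

lemma dual_tendsto_Lim:
  assumes U: "ultrafilter U" and a: "\<forall>\<^sub>F i in U. norm (a i) \<le> R" and f: "f \<in> banach_dual smul"
  shows "((\<lambda>i. f (a i)) \<longlongrightarrow> Lim U (\<lambda>i. f (a i))) U"
    and "norm (Lim U (\<lambda>i. f (a i))) \<le> R * dual_norm UNIV norm f"
proof -
  have "\<forall>\<^sub>F i in U. norm (f (a i)) \<le> R * dual_norm UNIV norm f"
    using a
  proof eventually_elim
    case (elim i)
    show ?case
      using banach_dual_bound[OF f, of "a i"] mult_left_mono[OF elim banach_dual_norm_nonneg[OF f]]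
      by (simp add: mult.commute)
  qed
  then show "((\<lambda>i. f (a i)) \<longlongrightarrow> Lim U (\<lambda>i. f (a i))) U"
    and "norm (Lim U (\<lambda>i. f (a i))) \<le> R * dual_norm UNIV norm f"
    by (rule ultrafilter_tendsto_Lim[OF U] norm_Lim_le[OF U])+
qed

text \<open>This is the weak-star limit of the family \<open>a\<close> along \<open>U\<close>. It
  turns a limit of scalars \<open>f (a i)\<close> into the pairing of \<open>f\<close> with one
  element of the bidual, so that weak convergence in the dual and the Arens products can be applied
  to it.\<close>

lemma Lim_bidual:
  assumes U: "ultrafilter U" and a: "\<forall>\<^sub>F i in U. norm (a i) \<le> R"
  shows "restrict0 (banach_dual smul) (\<lambda>f. Lim U (\<lambda>i. f (a i))) \<in> banach_bidual smul"
proof -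
  note lim = dual_tendsto_Lim(1)[OF U a]
  have "Lim U (\<lambda>i. (f + g) (a i)) = Lim U (\<lambda>i. f (a i)) + Lim U (\<lambda>i. g (a i))"
    if "f \<in> banach_dual smul" "g \<in> banach_dual smul" for f g
    using tendsto_add[OF lim[OF that(1)] lim[OF that(2)]] by (intro Lim_eqI[OF U]) simp
  moreover have "Lim U (\<lambda>i. fun_scale c f (a i)) = c * Lim U (\<lambda>i. f (a i))"
    if "f \<in> banach_dual smul" for c f
    using tendsto_mult_left[OF lim[OF that]] by (intro Lim_eqI[OF U]) (simp add: fun_scale_def)
  moreover have "\<exists>C. \<forall>f\<in>banach_dual smul. norm (Lim U (\<lambda>i. f (a i))) \<le> C * dual_norm UNIV norm f"
    using dual_tendsto_Lim(2)[OF U a] by blast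
  ultimately show ?thesis
    by (auto simp: banach_bidual_def dual_space_def restrict0_def banach_dual_plus banach_dual_fun_scale)
qed

lemma evaluation_bidual: "restrict0 (banach_dual smul) (\<lambda>f. f v) \<in> banach_bidual smul"
proof -
  have "norm (f v) \<le> norm v * dual_norm UNIV norm f" if "f \<in> banach_dual smul" for f
    using banach_dual_bound[OF that, of v] by (simp add: mult.commute)
  then have "\<exists>C. \<forall>f\<in>banach_dual smul. norm (f v) \<le> C * dual_norm UNIV norm f"
    by blast
  moreover have "fun_scale c f v = c * f v" for c and f :: "'a \<Rightarrow> 'k"
    by (simp add: fun_scale_def)
  ultimately show ?thesis
    by (auto simp: banach_bidual_def dual_space_def restrict0_def banach_dual_plus
        banach_dual_fun_scale)
qed

section \<open>Weakly almost periodic functionals\<close>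

text \<open>The space of a generated topology is the union of its generators, and the preimage of
  \<open>UNIV\<close> under the zero functional is already the whole dual.\<close>

lemma topspace_dual_weak: "topspace (dual_weak_topology smul) = banach_dual smul"
proof -
  have "(0 :: ('a \<Rightarrow> 'k) \<Rightarrow> 'k) \<in> dual_space fun_scale (banach_dual smul) (dual_norm UNIV norm)"
    by (rule dual_space_zero)
  then show ?thesis
    unfolding weak_topology_def topology_generated_by_topspace
    by (auto intro!: exI[of _ "banach_dual smul"] exI[of _ 0] exI[of _ UNIV])
qed

lemma continuous_map_bidual:
  assumes "m \<in> banach_bidual smul"
  shows "continuous_map (dual_weak_topology smul) euclidean m"
  unfolding continuous_map_def topspace_dual_weak
proof (intro conjI allI impI)
  fix V :: "'k set" assume "openin euclidean V"
  then show "openin (dual_weak_topology smul) {f \<in> banach_dual smul. m f \<in> V}"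
    unfolding weak_topology_def using assms
    by (intro topology_generated_by_Basis) (auto simp: banach_bidual_def)
qed simp

lemma continuous_map_into_dual_weak:
  assumes "\<And>x. x \<in> topspace T \<Longrightarrow> h x \<in> banach_dual smul"
    and "\<And>m. m \<in> banach_bidual smul \<Longrightarrow> continuous_map T euclidean (\<lambda>x. m (h x))"
  shows "continuous_map T (dual_weak_topology smul) h"
  unfolding weak_topology_def
proof (rule continuous_on_generated_topo)
  fix Q assume "Q \<in> {{v \<in> banach_dual smul. F v \<in> V} |F V.
      F \<in> dual_space fun_scale (banach_dual smul) (dual_norm UNIV norm) \<and> open V}"
  then obtain m V where mV: "m \<in> banach_bidual smul" "open V" "Q = {v \<in> banach_dual smul. m v \<in> V}"
    by (auto simp: banach_bidual_def)
  have "openin T {x \<in> topspace T. m (h x) \<in> V}"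
    using assms(2)[OF mV(1)] mV(2) by (simp add: openin_continuous_map_preimage)
  moreover have "h -` Q \<inter> topspace T = {x \<in> topspace T. m (h x) \<in> V}"
    using assms(1) mV(3) by auto
  ultimately show "openin T (h -` Q \<inter> topspace T)"
    by simp
next
  show "h ` topspace T \<subseteq> \<Union> {{v \<in> banach_dual smul. F v \<in> V} |F V.
      F \<in> dual_space fun_scale (banach_dual smul) (dual_norm UNIV norm) \<and> open V}"
    using topspace_dual_weak assms(1)
    unfolding weak_topology_def topology_generated_by_topspace by auto
qed

text \<open>Evaluations at points of the algebra belong to the bidual and separate functionals. The
  purpose is that weakly compact sets become weakly closed.\<close>

lemma Hausdorff_dual_weak: "Hausdorff_space (dual_weak_topology smul)"
  unfolding Hausdorff_space_def topspace_dual_weak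
proof (intro allI impI, elim conjE)
  fix f g :: "'a \<Rightarrow> 'k" assume fg: "f \<in> banach_dual smul" "g \<in> banach_dual smul" "f \<noteq> g"
  then obtain v where "f v \<noteq> g v" by blast
  then obtain V W where VW: "open V" "open W" "f v \<in> V" "g v \<in> W" "V \<inter> W = {}"
    by (metis hausdorff)
  let ?m = "restrict0 (banach_dual smul) (\<lambda>f. f v)"
  have "openin (dual_weak_topology smul) {f \<in> banach_dual smul. ?m f \<in> Q}" if "open Q" for Q
    using openin_continuous_map_preimage[OF continuous_map_bidual[OF evaluation_bidual[of v]], of Q]
      that unfolding topspace_dual_weak by simp
  then show "\<exists>P Q. openin (dual_weak_topology smul) P \<and> openin (dual_weak_topology smul) Q \<and>
      f \<in> P \<and> g \<in> Q \<and> disjnt P Q"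
    using VW fg
    by (intro exI[of _ "{f \<in> banach_dual smul. ?m f \<in> V}"] exI[of _ "{f \<in> banach_dual smul. ?m f \<in> W}"])
      (auto simp: restrict0_def disjnt_def)
qed

text \<open>A compact set containing the orbit is closed, hence contains the weak closure of the
  orbit. Closures of sums and multiples therefore never have to be computed: for these, continuous
  images of compact sets serve as \<open>C\<close>.\<close>

lemma WAP_I:
  assumes f: "f \<in> banach_dual smul" and C: "compactin (dual_weak_topology smul) C"
    and sub: "\<And>\<phi>. norm \<phi> \<le> 1 \<Longrightarrow> fact_r f \<phi> \<in> C"
  shows "f \<in> WAP smul"
proof -
  have "closedin (dual_weak_topology smul) C"
    by (rule compactin_imp_closedin[OF Hausdorff_dual_weak C])
  then have "(dual_weak_topology smul) closure_of {fact_r f \<phi> |\<phi>. norm \<phi> \<le> 1} \<subseteq> C"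
    using sub by (intro closure_of_minimal) auto
  then show ?thesis
    using f by (auto simp: WAP_def Let_def intro: closed_compactin[OF C])
qed

lemma WAP_compactin:
  assumes "f \<in> WAP smul"
  shows "\<exists>C. compactin (dual_weak_topology smul) C \<and> (\<forall>\<phi>. norm \<phi> \<le> 1 \<longrightarrow> fact_r f \<phi> \<in> C)"
proof -
  let ?C = "(dual_weak_topology smul) closure_of {fact_r f \<phi> |\<phi>. norm \<phi> \<le> 1}"
  have f: "f \<in> banach_dual smul" and C: "compactin (dual_weak_topology smul) ?C"
    using assms by (auto simp: WAP_def Let_def)
  have "{fact_r f \<phi> |\<phi>. norm \<phi> \<le> 1} \<subseteq> ?C"
    using fact_r_dual(1)[OF f] by (intro closure_of_subset) (auto simp: topspace_dual_weak)
  then show ?thesis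
    using C by blast
qed

lemma WAP_dual: "f \<in> WAP smul \<Longrightarrow> f \<in> banach_dual smul"
  by (auto simp: WAP_def)

lemma WAP_zero: "0 \<in> WAP smul"
proof (rule WAP_I)
  show "compactin (dual_weak_topology smul) {0}"
    by (simp add: compactin_sing topspace_dual_weak banach_dual_zero)
qed (auto simp: banach_dual_zero fact_r_def fun_eq_iff)

lemma WAP_plus:
  assumes "f \<in> WAP smul" and "g \<in> WAP smul"
  shows "f + g \<in> WAP smul"
proof -
  let ?T = "dual_weak_topology smul"
  have f: "f \<in> banach_dual smul"
    by (rule WAP_dual[OF assms(1)])
  obtain C where C: "compactin ?T C" "\<And>\<phi>. norm \<phi> \<le> 1 \<Longrightarrow> fact_r f \<phi> \<in> C"
    using WAP_compactin[OF assms(1)] by blast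
  have g: "g \<in> banach_dual smul"
    by (rule WAP_dual[OF assms(2)])
  obtain D where D: "compactin ?T D" "\<And>\<phi>. norm \<phi> \<le> 1 \<Longrightarrow> fact_r g \<phi> \<in> D"
    using WAP_compactin[OF assms(2)] by blast
  \<comment> \<open>Joint continuity holds because every bidual element is additive, so that after
    applying it only addition of scalars is left.\<close>
  have "continuous_map (prod_topology ?T ?T) ?T (\<lambda>p. fst p + snd p)"
  proof (rule continuous_map_into_dual_weak)
    fix m assume m: "m \<in> banach_bidual smul"
    have "continuous_map (prod_topology ?T ?T) euclidean (\<lambda>p. m (fst p) + m (snd p))"
      using continuous_map_compose[OF continuous_map_fst continuous_map_bidual[OF m], of ?T]
        continuous_map_compose[OF continuous_map_snd continuous_map_bidual[OF m], of ?T]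
      by (intro continuous_map_add) (simp_all add: comp_def)
    then show "continuous_map (prod_topology ?T ?T) euclidean (\<lambda>p. m (fst p + snd p))"
      by (rule continuous_map_eq) (auto simp: topspace_dual_weak banach_bidual_add[OF m])
  qed (auto simp: topspace_dual_weak banach_dual_plus)
  moreover have "compactin (prod_topology ?T ?T) (C \<times> D)"
    using C D by (simp add: compactin_Times)
  ultimately have "compactin ?T ((\<lambda>p. fst p + snd p) ` (C \<times> D))"
    by (rule image_compactin[rotated])
  then show ?thesis
  proof (rule WAP_I[OF banach_dual_plus[OF f g]])
    fix \<phi> :: 'a assume "norm \<phi> \<le> 1"
    then have "(fact_r f \<phi>, fact_r g \<phi>) \<in> C \<times> D"
      using C D by simp
    then show "fact_r (f + g) \<phi> \<in> (\<lambda>p. fst p + snd p) ` (C \<times> D)"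
      by (rule rev_image_eqI) (simp add: fact_r_def fun_eq_iff)
  qed
qed

lemma WAP_scale:
  assumes "f \<in> WAP smul"
  shows "fun_scale c f \<in> WAP smul"
proof -
  let ?T = "dual_weak_topology smul"
  have f: "f \<in> banach_dual smul"
    by (rule WAP_dual[OF assms])
  obtain C where C: "compactin ?T C" "\<And>\<phi>. norm \<phi> \<le> 1 \<Longrightarrow> fact_r f \<phi> \<in> C"
    using WAP_compactin[OF assms] by blast
  have "continuous_map ?T ?T (fun_scale c)"
  proof (rule continuous_map_into_dual_weak)
    fix m assume m: "m \<in> banach_bidual smul"
    have "continuous_map euclidean euclidean (\<lambda>z::'k. c * z)"
      by (auto intro!: continuous_intros)
    from continuous_map_compose[OF continuous_map_bidual[OF m] this]
    have "continuous_map ?T euclidean (\<lambda>g. c * m g)"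
      by (simp add: comp_def)
    then show "continuous_map ?T euclidean (\<lambda>g. m (fun_scale c g))"
      by (rule continuous_map_eq) (auto simp: topspace_dual_weak banach_bidual_scale[OF m])
  qed (auto simp: topspace_dual_weak banach_dual_fun_scale)
  then have "compactin ?T (fun_scale c ` C)"
    by (rule image_compactin[OF C(1)])
  then show ?thesis
  proof (rule WAP_I[OF banach_dual_fun_scale[OF f]])
    fix \<phi> :: 'a assume "norm \<phi> \<le> 1"
    then show "fact_r (fun_scale c f) \<phi> \<in> fun_scale c ` C"
      using C(2) by (intro rev_image_eqI[of "fact_r f \<phi>"]) (auto simp: fact_r_def fun_scale_def)
  qed
qed

section \<open>Iterated limits\<close>

text \<open>A common consequence of weak almost periodicity of \<open>f\<close> and of Arens
  regularity, so that one separation argument serves both conclusions. The index type does not occur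
  in \<open>f\<close> and is therefore passed as an argument.\<close>

definition iterated_limits_agree :: "('a \<Rightarrow> 'k) \<Rightarrow> 'i itself \<Rightarrow> bool" where
  "iterated_limits_agree f TYPE('i) \<longleftrightarrow>
    (\<forall>(U::'i filter) (V::'i filter) a b R. ultrafilter U \<longrightarrow> ultrafilter V \<longrightarrow>
      (\<forall>\<^sub>F i in U. norm (a i) \<le> R) \<longrightarrow> (\<forall>\<^sub>F j in V. norm (b j) \<le> R) \<longrightarrow>
      Lim U (\<lambda>i. Lim V (\<lambda>j. f (a i * b j))) = Lim V (\<lambda>j. Lim U (\<lambda>i. f (a i * b j))))"

text \<open>The easy half of Grothendieck's double limit criterion. By weak compactness the
  functionals \<open>fact_r f (a i)\<close> converge weakly to some \<open>h\<close> along
  \<open>U\<close>. Testing this with evaluation at \<open>v\<close> identifies \<open>h v\<close>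
  as the limit of \<open>f (a i * v)\<close>; testing it with the bidual limit of \<open>b\<close>
  along \<open>V\<close> gives the interchange.\<close>

lemma WAP_iterated_limits:
  assumes "f \<in> WAP smul"
  shows "iterated_limits_agree f TYPE('i)"
  unfolding iterated_limits_agree_def
proof (intro allI impI)
  fix U V :: "'i filter" and a b :: "'i \<Rightarrow> 'a" and R
  assume U: "ultrafilter U" and V: "ultrafilter V"
    and a: "\<forall>\<^sub>F i in U. norm (a i) \<le> R" and b: "\<forall>\<^sub>F j in V. norm (b j) \<le> R"
  let ?T = "dual_weak_topology smul"
  have f: "f \<in> banach_dual smul"
    by (rule WAP_dual[OF assms])
  obtain C where C: "compactin ?T C" "\<And>\<phi>. norm \<phi> \<le> 1 \<Longrightarrow> fact_r f \<phi> \<in> C"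
    using WAP_compactin[OF assms] by blast
  \<comment> \<open>Weak almost periodicity speaks of the unit ball, so \<open>a i\<close> is
    divided by \<open>S\<close>, and \<open>h\<close> below multiplies the limit by \<open>S\<close>
    again. The summand \<open>1\<close> keeps the divisor positive.\<close>
  define S where "S = \<bar>R\<bar> + 1"
  have S: "S > 0" by (simp add: S_def)
  define g where "g i = fact_r f (smul (of_real (1 / S)) (a i))" for i
  have "\<forall>\<^sub>F i in U. g i \<in> C"
    using a by eventually_elim (auto simp: g_def norm_scale norm_divide S_def intro!: C(2))
  then obtain l where l: "l \<in> C" "limitin ?T g l U"
    using ultrafilter_limitin_compactin[OF U C(1)] by blast
  define h where "h = fun_scale (of_real S) l"
  have "l \<in> banach_dual smul"
    using l(1) compactin_subset_topspace[OF C(1)] topspace_dual_weak by auto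
  then have h: "h \<in> banach_dual smul"
    by (simp add: h_def banach_dual_fun_scale)
  have weak: "((\<lambda>i. m (fact_r f (a i))) \<longlongrightarrow> m h) U" if m: "m \<in> banach_bidual smul" for m
  proof -
    have "((\<lambda>i. m (g i)) \<longlongrightarrow> m l) U"
      using continuous_map_limit[OF continuous_map_bidual[OF m] l(2)] by (simp add: comp_def)
    then have "((\<lambda>i. of_real S * m (g i)) \<longlongrightarrow> of_real S * m l) U"
      by (rule tendsto_mult_left)
    moreover have "fact_r f (a i) = fun_scale (of_real S) (g i)" for i
      using S by (simp add: fact_r_def fun_scale_def g_def fun_eq_iff mult_scale_left
          banach_dual_scale[OF f])
    then have "m (fact_r f (a i)) = of_real S * m (g i)" for i
      by (simp add: banach_bidual_scale[OF m] g_def fact_r_dual(1)[OF f])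
    ultimately show ?thesis
      by (simp add: h_def banach_bidual_scale[OF m \<open>l \<in> banach_dual smul\<close>])
  qed
  have "Lim U (\<lambda>i. f (a i * v)) = h v" for v
    using weak[OF evaluation_bidual[of v]] fact_r_dual(1)[OF f] h
    by (intro Lim_eqI[OF U]) (simp add: restrict0_def fact_r_def)
  moreover have "Lim U (\<lambda>i. Lim V (\<lambda>j. f (a i * b j))) = Lim V (\<lambda>j. h (b j))"
    using weak[OF Lim_bidual[OF V b]] fact_r_dual(1)[OF f] h
    by (intro Lim_eqI[OF U]) (simp add: restrict0_def fact_r_def)
  ultimately show "Lim U (\<lambda>i. Lim V (\<lambda>j. f (a i * b j))) = Lim V (\<lambda>j. Lim U (\<lambda>i. f (a i * b j)))"
    by simp
qed

text \<open>For the bidual limits \<open>?m\<close> of \<open>a\<close> along \<open>U\<close> and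
  \<open>?n\<close> of \<open>b\<close> along \<open>V\<close>, the two Arens products evaluated at
  \<open>f\<close> unfold to the two iterated limits.\<close>

lemma arens_regular_iterated_limits:
  assumes reg: "arens_regular smul" and f: "f \<in> banach_dual smul"
  shows "iterated_limits_agree f TYPE('i)"
  unfolding iterated_limits_agree_def
proof (intro allI impI)
  fix U V :: "'i filter" and a b :: "'i \<Rightarrow> 'a" and R
  assume U: "ultrafilter U" and V: "ultrafilter V"
    and a: "\<forall>\<^sub>F i in U. norm (a i) \<le> R" and b: "\<forall>\<^sub>F j in V. norm (b j) \<le> R"
  let ?m = "restrict0 (banach_dual smul) (\<lambda>f. Lim U (\<lambda>i. f (a i)))"
  let ?n = "restrict0 (banach_dual smul) (\<lambda>f. Lim V (\<lambda>j. f (b j)))"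
  note m = Lim_bidual[OF U a] and n = Lim_bidual[OF V b]
  have "arens_first smul ?m ?n f = arens_second smul ?m ?n f"
    using reg m n unfolding arens_regular_def by simp
  moreover have "arens_first smul ?m ?n f = Lim U (\<lambda>i. Lim V (\<lambda>j. f (a i * b j)))"
  proof -
    have "arens_first smul ?m ?n f = ?m (\<lambda>\<phi>. ?n (fact_r f \<phi>))"
      using f by (simp add: arens_first_def restrict0_def)
    also have "\<dots> = Lim U (\<lambda>i. ?n (fact_r f (a i)))"
      using bidual_fact_dual(1)[OF f n] by (subst restrict0_def) simp
    also have "\<dots> = Lim U (\<lambda>i. Lim V (\<lambda>j. f (a i * b j)))"
      using fact_r_dual(1)[OF f] by (simp add: restrict0_def) (simp add: fact_r_def)
    finally show ?thesis .
  qed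
  moreover have "arens_second smul ?m ?n f = Lim V (\<lambda>j. Lim U (\<lambda>i. f (a i * b j)))"
  proof -
    have "arens_second smul ?m ?n f = ?n (\<lambda>\<phi>. ?m (fact_l \<phi> f))"
      using f by (simp add: arens_second_def restrict0_def)
    also have "\<dots> = Lim V (\<lambda>j. ?m (fact_l (b j) f))"
      using bidual_fact_dual(2)[OF f m] by (subst restrict0_def) simp
    also have "\<dots> = Lim V (\<lambda>j. Lim U (\<lambda>i. f (a i * b j)))"
      using fact_l_dual(1)[OF f] by (simp add: restrict0_def) (simp add: fact_l_def)
    finally show ?thesis .
  qed
  ultimately show "Lim U (\<lambda>i. Lim V (\<lambda>j. f (a i * b j))) = Lim V (\<lambda>j. Lim U (\<lambda>i. f (a i * b j)))"
    by simp
qed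

end

section \<open>The Hahn-Banach theorem\<close>

definition sublinear :: "('v::real_vector \<Rightarrow> real) \<Rightarrow> bool" where
  "sublinear p \<longleftrightarrow> (\<forall>x y. p (x + y) \<le> p x + p y) \<and> (\<forall>t x. 0 \<le> t \<longrightarrow> p (t *\<^sub>R x) = t * p x)"

lemma sublinear_add: "sublinear p \<Longrightarrow> p (x + y) \<le> p x + p y"
  and sublinear_scale: "sublinear p \<Longrightarrow> 0 \<le> t \<Longrightarrow> p (t *\<^sub>R x) = t * p x"
  by (auto simp: sublinear_def)

lemma sublinear_zero: "sublinear p \<Longrightarrow> p 0 = 0"
  using sublinear_scale[of p 0 0] by simp

lemma sublinear_minus: "sublinear p \<Longrightarrow> - p (- x) \<le> p x"
  using sublinear_add[of p x "- x"] sublinear_zero[of p] by simp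

text \<open>This covers three infima at once: that of a chain in Zorn's lemma, the competitor of a
  minimal functional, and the convolution of a functional with a multiple of the norm. The minorant
  \<open>L\<close> keeps the infimum finite and, by \<open>L 0 = 0\<close>, keeps its value at
  \<open>0\<close> from dropping below \<open>0\<close>.\<close>

lemma sublinear_INF:
  fixes \<Phi> :: "'i \<Rightarrow> 'v::real_vector \<Rightarrow> real"
  assumes lower: "\<And>i x. i \<in> I \<Longrightarrow> L x \<le> \<Phi> i x" and "L 0 = 0"
    and zero: "\<exists>i\<in>I. \<Phi> i 0 \<le> 0"
    and add: "\<And>i j x y. i \<in> I \<Longrightarrow> j \<in> I \<Longrightarrow> \<exists>k\<in>I. \<Phi> k (x + y) \<le> \<Phi> i x + \<Phi> j y"
    and scale: "\<And>i t x. i \<in> I \<Longrightarrow> 0 < t \<Longrightarrow> \<exists>k\<in>I. \<Phi> k (t *\<^sub>R x) \<le> t * \<Phi> i x"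
  shows "sublinear (\<lambda>x. INF i\<in>I. \<Phi> i x) \<and> (\<forall>i\<in>I. \<forall>x. (INF i\<in>I. \<Phi> i x) \<le> \<Phi> i x)"
proof -
  let ?q = "\<lambda>x. INF i\<in>I. \<Phi> i x"
  have ne: "I \<noteq> {}"
    using zero by blast
  have le: "?q x \<le> \<Phi> i x" if "i \<in> I" for i x
    using that lower by (intro cINF_lower bdd_belowI2[where m = "L x"])
  have q_add: "?q (x + y) \<le> ?q x + ?q y" for x y
  proof -
    have "?q (x + y) - \<Phi> j y \<le> \<Phi> i x" if "i \<in> I" "j \<in> I" for i j
    proof -
      obtain k where "k \<in> I" "\<Phi> k (x + y) \<le> \<Phi> i x + \<Phi> j y"
        using add[OF \<open>i \<in> I\<close> \<open>j \<in> I\<close>] by blast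
      then show ?thesis
        using le[of k "x + y"] by linarith
    qed
    then have "?q (x + y) - \<Phi> j y \<le> ?q x" if "j \<in> I" for j
      using that by (intro cINF_greatest[OF ne])
    then have "?q (x + y) - ?q x \<le> \<Phi> j y" if "j \<in> I" for j
      using that by (metis diff_le_eq le_diff_eq add.commute)
    then have "?q (x + y) - ?q x \<le> ?q y"
      by (intro cINF_greatest[OF ne])
    then show ?thesis by linarith
  qed
  have q_scale: "?q (t *\<^sub>R x) \<le> t * ?q x" if t: "0 < t" for t x
  proof -
    have "?q (t *\<^sub>R x) / t \<le> \<Phi> i x" if i: "i \<in> I" for i
    proof -
      obtain k where "k \<in> I" "\<Phi> k (t *\<^sub>R x) \<le> t * \<Phi> i x"
        using scale[OF i t] by blast
      then have "?q (t *\<^sub>R x) \<le> t * \<Phi> i x"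
        using le[of k "t *\<^sub>R x"] by linarith
      then show ?thesis
        using t by (simp add: divide_le_eq mult.commute)
    qed
    then have "?q (t *\<^sub>R x) / t \<le> ?q x"
      by (intro cINF_greatest[OF ne])
    then show ?thesis
      using t by (simp add: divide_le_eq mult.commute)
  qed
  have q_zero: "?q 0 = 0"
  proof (rule antisym)
    show "?q 0 \<le> 0"
      using zero le order_trans by blast
    show "0 \<le> ?q 0"
      using lower[of _ 0] \<open>L 0 = 0\<close> by (intro cINF_greatest[OF ne]) auto
  qed
  have "?q (t *\<^sub>R x) = t * ?q x" if "0 \<le> t" for t x
  proof (cases "t = 0")
    case False
    then have t: "0 < t" using that by simp
    \<comment> \<open>The opposite inequality is \<open>q_scale\<close> for the factor
      \<open>1 / t\<close>.\<close>
    have "?q x \<le> (1 / t) * ?q (t *\<^sub>R x)"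
      using q_scale[of "1 / t" "t *\<^sub>R x"] t by simp
    then have "t * ?q x \<le> ?q (t *\<^sub>R x)"
      using t by (simp add: field_simps)
    then show ?thesis
      using q_scale[OF t, of x] by simp
  qed (simp add: q_zero)
  then show ?thesis
    using q_add le by (simp add: sublinear_def)
qed

text \<open>Among the sublinear functionals below \<open>p\<close>, the minimal ones are linear.\<close>

lemma sublinear_ge_linear:
  fixes p :: "'v::real_vector \<Rightarrow> real"
  assumes p: "sublinear p"
  obtains l where "linear l" and "\<And>x. l x \<le> p x"
proof -
  define A where "A = {q. sublinear q \<and> q \<le> p}"
  have "\<exists>m\<in>A. \<forall>q\<in>A. q \<le> m \<longrightarrow> q = m"
  proof (rule predicate_Zorn)
    show "partial_order_on A (relation_of (\<lambda>x y. y \<le> x) A)"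
      by (rule partial_order_on_relation_ofI) auto
    fix C assume C: "C \<in> Chains (relation_of (\<lambda>x y. y \<le> x) A)"
    then have CA: "C \<subseteq> A" and chain: "\<And>a b. a \<in> C \<Longrightarrow> b \<in> C \<Longrightarrow> a \<le> b \<or> b \<le> a"
      by (auto simp: Chains_def relation_of_def)
    show "\<exists>u\<in>A. \<forall>a\<in>C. u \<le> a"
    proof (cases "C = {}")
      case True
      then show ?thesis using p by (auto simp: A_def)
    next
      case False
      have sub: "sublinear q" and le: "q x \<le> p x" if "q \<in> C" for q x
        using that CA by (auto simp: A_def le_fun_def)
      let ?u = "\<lambda>x. INF q\<in>C. q x"
      have "sublinear ?u \<and> (\<forall>q\<in>C. \<forall>x. ?u x \<le> q x)"
      \<comment> \<open>Every sublinear \<open>q \<le> p\<close> satisfies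
        \<open>- p (- x) \<le> - q (- x) \<le> q x\<close>, which bounds the whole chain below
        independently of its length.\<close>
      proof (rule sublinear_INF[where \<Phi> = "\<lambda>q. q" and L = "\<lambda>x. - p (- x)"])
        show "- p (- x) \<le> q x" if "q \<in> C" for q x
          using sublinear_minus[OF sub[OF that], of x] le[OF that, of "- x"] by linarith
        show "- p (- 0) = 0"
          by (simp add: sublinear_zero[OF p])
        show "\<exists>q\<in>C. q 0 \<le> 0"
          using False sub by (auto simp: sublinear_zero)
        fix q q' x y assume q: "q \<in> C" "q' \<in> C"
        have "q (x + y) \<le> q x + q y" "q' (x + y) \<le> q' x + q' y"
          using q sub sublinear_add by blast+
        moreover have "(q x \<le> q' x \<and> q y \<le> q' y) \<or> (q' x \<le> q x \<and> q' y \<le> q y)"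
          using chain[OF q] by (auto simp: le_fun_def)
        ultimately show "\<exists>k\<in>C. k (x + y) \<le> q x + q' y"
          using q by (smt (verit))
      next
        fix q and t :: real and x assume "q \<in> C" "0 < t"
        then show "\<exists>k\<in>C. k (t *\<^sub>R x) \<le> t * q x"
          using sublinear_scale[OF sub, of q t x] by (intro bexI[of _ q]) auto
      qed
      then have u: "sublinear ?u" and u_le: "\<And>q x. q \<in> C \<Longrightarrow> ?u x \<le> q x"
        by blast+
      obtain q where "q \<in> C"
        using False by blast
      then have "?u x \<le> p x" for x
        using u_le[of q x] le[of q x] by linarith
      then have "?u \<in> A"
        using u by (simp add: A_def le_fun_def)
      then show ?thesis
        using u_le by (intro bexI[of _ ?u]) (auto simp: le_fun_def)
    qed
  qed
  then obtain l where "l \<in> A" and min: "\<And>q. q \<in> A \<Longrightarrow> q \<le> l \<Longrightarrow> q = l"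
    by blast
  then have l: "sublinear l" and lp: "l \<le> p"
    by (auto simp: A_def)
  have super: "l x + l y \<le> l (x + y)" for x y
  proof -
    \<comment> \<open>A competitor for the minimal \<open>l\<close>: its term at
      \<open>t = 0\<close> is \<open>l x\<close>, so minimality forces \<open>?q = l\<close>, and
      then the term at \<open>t = 1\<close> gives superadditivity.\<close>
    let ?q = "\<lambda>x. INF t\<in>{0..}. l (x + t *\<^sub>R y) - t * l y"
    have "sublinear ?q \<and> (\<forall>t\<in>{0..}. \<forall>x. ?q x \<le> l (x + t *\<^sub>R y) - t * l y)"
    proof (rule sublinear_INF[where \<Phi> = "\<lambda>t x. l (x + t *\<^sub>R y) - t * l y" and L = "\<lambda>x. - l (- x)"])
      show "- l (- x) \<le> l (x + t *\<^sub>R y) - t * l y" if "t \<in> {0..}" for t x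
        using sublinear_add[OF l, of "- x" "x + t *\<^sub>R y"] sublinear_scale[OF l, of t y] that by simp
      show "- l (- 0) = 0" by (simp add: sublinear_zero[OF l])
      show "\<exists>t\<in>{0..}. l (0 + t *\<^sub>R y) - t * l y \<le> 0"
        by (intro bexI[of _ 0]) (auto simp: sublinear_zero[OF l])
      show "\<exists>k\<in>{0..}. l (u + v + k *\<^sub>R y) - k * l y \<le> l (u + s *\<^sub>R y) - s * l y + (l (v + t *\<^sub>R y) - t * l y)"
        if "s \<in> {0..}" "t \<in> {0..}" for s t :: real and u v
        using that sublinear_add[OF l, of "u + s *\<^sub>R y" "v + t *\<^sub>R y"]
        by (intro bexI[of _ "s + t"]) (auto simp: algebra_simps)
      show "\<exists>k\<in>{0..}. l (c *\<^sub>R x + k *\<^sub>R y) - k * l y \<le> c * (l (x + t *\<^sub>R y) - t * l y)"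
        if "t \<in> {0..}" "0 < c" for c t :: real and x
        using that sublinear_scale[OF l, of c "x + t *\<^sub>R y"]
        by (intro bexI[of _ "c * t"]) (auto simp: algebra_simps)
    qed
    then have q: "sublinear ?q" and q_le: "\<And>t x. 0 \<le> t \<Longrightarrow> ?q x \<le> l (x + t *\<^sub>R y) - t * l y"
      by auto
    have "?q \<le> l"
      using q_le[of 0] by (simp add: le_fun_def)
    then have "?q = l"
      using q lp by (intro min) (auto simp: A_def)
    then have "?q x = l x"
      by (rule fun_cong)
    then show ?thesis
      using q_le[of 1 x] by simp
  qed
  have add: "l (x + y) = l x + l y" for x y
    using super[of x y] sublinear_add[OF l, of x y] by linarith
  have minus: "l (- x) = - l x" for x
    using add[of x "- x"] sublinear_zero[OF l] by simp
  have "l (t *\<^sub>R x) = t * l x" for t x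
  proof (cases "0 \<le> t")
    case True
    then show ?thesis by (rule sublinear_scale[OF l])
  next
    case False
    then show ?thesis
      using sublinear_scale[OF l, of "- t" x] minus[of "t *\<^sub>R x"] by simp
  qed
  then have "linear l"
    by (intro linearI) (simp_all add: add)
  then show thesis
    using that lp by (auto simp: le_fun_def)
qed

text \<open>The infimum \<open>?q\<close> merges the two constraints: its term at
  \<open>s = 0\<close> gives \<open>?q x \<le> C * norm x\<close>, and for \<open>x \<in> S\<close>
  its term at \<open>s = x\<close> gives \<open>?q x \<le> g x\<close>. A linear functional below
  \<open>?q\<close> is thus bounded by the norm and lies below \<open>g\<close> on \<open>S\<close>;
  applying the latter to \<open>x\<close> and \<open>- x\<close> gives equality there.\<close>

theorem real_Hahn_Banach:
  fixes g :: "'v::real_normed_vector \<Rightarrow> real"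
  assumes S: "0 \<in> S" "\<And>x y. x \<in> S \<Longrightarrow> y \<in> S \<Longrightarrow> x + y \<in> S" "\<And>t x. x \<in> S \<Longrightarrow> t *\<^sub>R x \<in> S"
    and g_add: "\<And>x y. x \<in> S \<Longrightarrow> y \<in> S \<Longrightarrow> g (x + y) = g x + g y"
    and g_scale: "\<And>t x. x \<in> S \<Longrightarrow> g (t *\<^sub>R x) = t * g x"
    and g_bound: "\<And>x. x \<in> S \<Longrightarrow> \<bar>g x\<bar> \<le> C * norm x" and C: "0 \<le> C"
  obtains l where "linear l" and "\<And>x. x \<in> S \<Longrightarrow> l x = g x" and "\<And>x. \<bar>l x\<bar> \<le> C * norm x"
proof -
  let ?q = "\<lambda>x. INF s\<in>S. g s + C * norm (x - s)"
  have g0: "g 0 = 0"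
    using g_scale[OF S(1), of 0] by simp
  have "sublinear ?q \<and> (\<forall>s\<in>S. \<forall>x. ?q x \<le> g s + C * norm (x - s))"
  proof (rule sublinear_INF[where \<Phi> = "\<lambda>s x. g s + C * norm (x - s)" and L = "\<lambda>x. - (C * norm x)"])
    show "- (C * norm x) \<le> g s + C * norm (x - s)" if "s \<in> S" for s x
    proof -
      have "C * norm s \<le> C * (norm x + norm (x - s))"
        using C norm_triangle_ineq4[of x "x - s"] by (intro mult_left_mono) auto
      then show ?thesis
        using g_bound[OF that] by (simp add: distrib_left)
    qed
    show "\<exists>s\<in>S. g s + C * norm (0 - s) \<le> 0"
      using S(1) g0 by (intro bexI[of _ 0]) auto
    show "\<exists>k\<in>S. g k + C * norm (x + y - k) \<le> g s + C * norm (x - s) + (g t + C * norm (y - t))"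
      if "s \<in> S" "t \<in> S" for s t x y
    proof (intro bexI)
      have "norm (x + y - (s + t)) \<le> norm (x - s) + norm (y - t)"
        using norm_triangle_ineq[of "x - s" "y - t"] by (simp add: algebra_simps)
      then have "C * norm (x + y - (s + t)) \<le> C * (norm (x - s) + norm (y - t))"
        using C by (rule mult_left_mono)
      then show "g (s + t) + C * norm (x + y - (s + t)) \<le> g s + C * norm (x - s) + (g t + C * norm (y - t))"
        using g_add[OF that] by (simp add: distrib_left)
    qed (use S(2) that in blast)
    show "\<exists>k\<in>S. g k + C * norm (t *\<^sub>R x - k) \<le> t * (g s + C * norm (x - s))"
      if "s \<in> S" "0 < t" for s t x
    proof (intro bexI)
      have "norm (t *\<^sub>R x - t *\<^sub>R s) = t * norm (x - s)"
        using \<open>0 < t\<close> by (metis abs_of_pos norm_scaleR scaleR_right_diff_distrib)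
      then show "g (t *\<^sub>R s) + C * norm (t *\<^sub>R x - t *\<^sub>R s) \<le> t * (g s + C * norm (x - s))"
        using g_scale[OF \<open>s \<in> S\<close>] by (simp add: algebra_simps)
    qed (use S(3) that in blast)
  qed simp
  then have q: "sublinear ?q" and q_le: "\<And>s x. s \<in> S \<Longrightarrow> ?q x \<le> g s + C * norm (x - s)"
    by blast+
  obtain l where l: "linear l" and lq: "\<And>x. l x \<le> ?q x"
    using sublinear_ge_linear[OF q] by blast
  have le: "l x \<le> C * norm x" for x
    using lq[of x] q_le[OF S(1), of x] g0 by simp
  have l_le_g: "l x \<le> g x" if "x \<in> S" for x
    using lq[of x] q_le[OF that, of x] by simp
  have "l x = g x" if "x \<in> S" for x
    using l_le_g[OF that] l_le_g[OF S(3)[OF that, of "- 1"]] g_scale[OF that, of "- 1"]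
      linear_neg[OF l, of x] by simp
  moreover have "\<bar>l x\<bar> \<le> C * norm x" for x
    using le[of x] le[of "- x"] linear_neg[OF l, of x] by simp
  ultimately show thesis
    using that l by blast
qed

context banach_algebra
begin

text \<open>Over the complex numbers a functional is recovered from its real part by
  \<open>F x = l x - i * l (i x)\<close>, so only real functionals have to be extended. The result
  is bounded but its norm is not kept; boundedness is what the contradiction with Arens regularity
  uses.\<close>

theorem Hahn_Banach:
  assumes f: "f \<in> dual_space smul S norm" and S: "subspace S"
  obtains F where "F \<in> banach_dual smul" and "\<And>v. v \<in> S \<Longrightarrow> F v = f v"
proof -
  have f_add: "f (u + v) = f u + f v" and f_scale: "f (smul c u) = c * f u"
    if "u \<in> S" "v \<in> S" for u v c
    using f that by (auto simp: dual_space_def)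
  have f_scaleR: "f (t *\<^sub>R u) = t *\<^sub>R f u" if "u \<in> S" for t u
    using f_scale[OF that that, of "of_real t"] by (simp add: scale_of_real scaleR_conv_of_real)
  have S_scaleR: "t *\<^sub>R u \<in> S" if "u \<in> S" for t u
    using subspace_scale[OF S that, of "of_real t"] by (simp add: scale_of_real)
  define C where "C = dual_norm S norm f"
  have C: "0 \<le> C" and f_bound: "\<And>v. v \<in> S \<Longrightarrow> norm (f v) \<le> C * norm v"
    using dual_norm_nonneg[OF f subspace_0[OF S]] dual_norm_bound[OF f S] by (auto simp: C_def)
  have extend: "\<exists>l. linear l \<and> (\<forall>x\<in>S. l x = re (f x)) \<and> (\<forall>x. \<bar>l x\<bar> \<le> C * norm x)"
    if re: "linear re" "\<And>z. \<bar>re z\<bar> \<le> norm z" for re :: "'k \<Rightarrow> real"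
  proof -
    have bound: "\<bar>re (f x)\<bar> \<le> C * norm x" if "x \<in> S" for x
      using re(2)[of "f x"] f_bound[OF that] by linarith
    obtain l where "linear l" "\<And>x. x \<in> S \<Longrightarrow> l x = re (f x)" "\<And>x. \<bar>l x\<bar> \<le> C * norm x"
      by (rule real_Hahn_Banach[of S "\<lambda>x. re (f x)" C])
        (simp_all add: subspace_0[OF S] subspace_add[OF S] S_scaleR C bound f_add f_scaleR
          linear_add[OF re(1)] linear_scale[OF re(1)])
    then show ?thesis by blast
  qed
  show thesis
    using real_or_complex[where 'a='k]
  proof
    assume "\<forall>x::'k. \<exists>s. x = s *\<^sub>R 1"
    then obtain re :: "'k \<Rightarrow> real" where re: "\<And>z. z = re z *\<^sub>R 1"
      by metis
    have re_eqI: "re z = s" if "z = s *\<^sub>R 1" for z s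
      using trans[OF re[of z, symmetric] that] by simp
    have "re (y + z) = re y + re z" for y z
      by (rule re_eqI) (simp only: scaleR_left_distrib re[symmetric])
    moreover have "re (t *\<^sub>R z) = t * re z" for t z
      by (rule re_eqI) (simp only: scaleR_scaleR[symmetric] re[symmetric])
    moreover have "\<bar>re z\<bar> \<le> norm z" for z
    proof -
      have "norm (re z *\<^sub>R (1::'k)) = \<bar>re z\<bar>" by simp
      then show ?thesis by (simp only: re[symmetric])
    qed
    ultimately have "linear re" "\<And>z. \<bar>re z\<bar> \<le> norm z"
      by (simp_all add: linearI)
    then obtain l where l: "linear l" "\<And>x. x \<in> S \<Longrightarrow> l x = re (f x)" "\<And>x. \<bar>l x\<bar> \<le> C * norm x"
      using extend[of re] by blast
    have re_of_real: "of_real (re z) = z" for z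
      unfolding of_real_def by (rule re[symmetric])
    have "smul c x = re c *\<^sub>R x" for c x
      using scale_of_real[of "re c" x] by (simp only: re_of_real)
    then have "of_real (l (smul c x)) = c * of_real (l x)" for c x
      by (simp add: linear_scale[OF l(1)] re_of_real)
    then have "(\<lambda>x. of_real (l x)) \<in> banach_dual smul"
      using l(3) by (intro banach_dualI[where C = C]) (auto simp: linear_add[OF l(1)])
    then show thesis
      by (rule that) (simp add: l(2) re_of_real)
  next
    assume "\<exists>i::'k. i * i = - 1 \<and> (\<forall>x. \<exists>s t. x = s *\<^sub>R 1 + t *\<^sub>R i \<and> norm x = sqrt (s\<^sup>2 + t\<^sup>2))"
    then obtain i :: 'k where ii: "i * i = - 1"
      and "\<forall>x. \<exists>s t. x = s *\<^sub>R 1 + t *\<^sub>R i \<and> norm x = sqrt (s\<^sup>2 + t\<^sup>2)"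
      by blast
    then have "\<forall>x. \<exists>s t. x = of_real s + of_real t * i \<and> norm x = sqrt (s\<^sup>2 + t\<^sup>2)"
      by (simp add: scaleR_conv_of_real)
    then obtain re im :: "'k \<Rightarrow> real" where decomp: "\<And>z. of_real (re z) + of_real (im z) * i = z"
      and nrm: "\<And>z. norm z = sqrt ((re z)\<^sup>2 + (im z)\<^sup>2)"
      by metis
    \<comment> \<open>The coordinates \<open>re\<close> and \<open>im\<close> come from a mere
      choice. Squaring shows that a real scalar which is a real multiple of \<open>i\<close>
      vanishes; this makes \<open>re\<close> independent of the choice and hence linear.\<close>
    have not_real: "w = 0" if w: "of_real w = of_real v * i" for w v
    proof -
      have "(of_real v * i)\<^sup>2 = (of_real v)\<^sup>2 * (i * i)"
        by (simp add: power2_eq_square algebra_simps)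
      then have "(of_real (w\<^sup>2 + v\<^sup>2) :: 'k) = 0"
        using w ii by simp
      then have "w\<^sup>2 + v\<^sup>2 = 0"
        by (simp only: of_real_eq_0_iff)
      then show ?thesis
        by (simp add: sum_power2_eq_zero_iff)
    qed
    have re_eqI: "re z = s" if "of_real s + of_real t * i = z" for z s t
    proof -
      have "of_real s - of_real (re z) = (of_real (im z) - of_real t) * i"
        using trans[OF that decomp[of z, symmetric]] by (simp add: algebra_simps)
      then have "s - re z = 0"
        by (intro not_real[of "s - re z" "im z - t"]) simp
      then show ?thesis by simp
    qed
    have "re (y + z) = re y + re z" for y z
    proof (rule re_eqI)
      have "of_real (re y + re z) + of_real (im y + im z) * i
          = (of_real (re y) + of_real (im y) * i) + (of_real (re z) + of_real (im z) * i)"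
        by (simp add: algebra_simps)
      then show "of_real (re y + re z) + of_real (im y + im z) * i = y + z"
        by (simp only: decomp)
    qed
    moreover have "re (t *\<^sub>R z) = t * re z" for t z
    proof (rule re_eqI)
      have "of_real (t * re z) + of_real (t * im z) * i = t *\<^sub>R (of_real (re z) + of_real (im z) * i)"
        by (simp add: scaleR_conv_of_real distrib_left mult.assoc)
      then show "of_real (t * re z) + of_real (t * im z) * i = t *\<^sub>R z"
        by (simp only: decomp)
    qed
    moreover have "\<bar>re z\<bar> \<le> norm z" for z
      unfolding nrm by (rule real_le_rsqrt) simp
    ultimately have "linear re" "\<And>z. \<bar>re z\<bar> \<le> norm z"
      by (simp_all add: linearI)
    then obtain l where l: "linear l" "\<And>x. x \<in> S \<Longrightarrow> l x = re (f x)" "\<And>x. \<bar>l x\<bar> \<le> C * norm x"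
      using extend[of re] by blast
    have ii_mult: "i * (i * z) = - z" for z
      using ii by (simp flip: mult.assoc)
    define F where "F x = of_real (l x) - i * of_real (l (smul i x))" for x
    have smul_decomp: "smul c x = re c *\<^sub>R x + im c *\<^sub>R smul i x" for c x
    proof -
      have "smul (of_real (re c) + of_real (im c) * i) x = re c *\<^sub>R x + im c *\<^sub>R smul i x"
        by (simp add: scale_left_distrib scale_of_real del: scale_scale flip: scale_scale)
      then show ?thesis
        by (simp only: decomp)
    qed
    have F_scale: "F (smul c x) = c * F x" for c x
    proof -
      have "smul i (smul c x) = smul c (smul i x)"
        by (simp add: mult.commute)
      also have "\<dots> = re c *\<^sub>R smul i x + im c *\<^sub>R smul (i * i) x"
        unfolding smul_decomp[of c] by simp
      also have "\<dots> = re c *\<^sub>R smul i x - im c *\<^sub>R x"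
        by (simp add: ii)
      finally have "F (smul c x) = of_real (re c * l x + im c * l (smul i x))
          - i * of_real (re c * l (smul i x) - im c * l x)"
        unfolding F_def smul_decomp[of c]
        by (simp add: linear_add[OF l(1)] linear_diff[OF l(1)] linear_scale[OF l(1)])
      also have "\<dots> = (of_real (re c) + of_real (im c) * i) * of_real (l x)
          - of_real (re c) * i * of_real (l (smul i x)) + of_real (im c) * of_real (l (smul i x))"
        by (simp add: algebra_simps)
      also have "\<dots> = (of_real (re c) + of_real (im c) * i) * F x"
        by (simp add: F_def algebra_simps ii_mult)
      finally show ?thesis
        using decomp[of c] by simp
    qed
    have "norm (F x) \<le> (C + norm i * (C * norm i)) * norm x" for x
    proof -
      have "norm (F x) \<le> \<bar>l x\<bar> + norm i * \<bar>l (smul i x)\<bar>"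
        unfolding F_def using norm_triangle_ineq4[of "of_real (l x)" "i * of_real (l (smul i x))"]
        by (simp add: norm_mult)
      also have "\<dots> \<le> C * norm x + norm i * (C * norm (smul i x))"
        by (intro add_mono mult_left_mono l(3)) auto
      finally show ?thesis
        by (simp add: norm_scale algebra_simps)
    qed
    then have "F \<in> banach_dual smul"
      by (intro banach_dualI F_scale)
        (simp add: F_def scale_right_distrib linear_add[OF l(1)] algebra_simps)
    moreover have "F v = f v" if "v \<in> S" for v
    proof -
      have "i * (of_real (re (f v)) + of_real (im (f v)) * i) = of_real (re (f v)) * i + of_real (im (f v)) * (i * i)"
        by (simp add: algebra_simps)
      then have "of_real (- im (f v)) + of_real (re (f v)) * i = i * f v"
        by (simp add: decomp ii)
      then have "re (i * f v) = - im (f v)"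
        by (rule re_eqI)
      then have "l (smul i v) = - im (f v)"
        using l(2)[OF subspace_scale[OF S that]] f_scale[OF that that] by simp
      then show ?thesis
        using l(2)[OF that] decomp[of "f v"] by (simp add: F_def mult.commute)
    qed
    ultimately show thesis
      by (rule that)
  qed
qed

end

section \<open>Functionals on the span of an \<open>\<ell>\<^sup>1\<close>-base\<close>

context banach_algebra
begin

lemma l1_base_sum:
  assumes X: "l1_base smul \<eta> K X" and F: "finite F" "F \<subseteq> X"
  shows "(\<Sum>x\<in>F. norm (u x)) \<le> K * norm (\<Sum>x\<in>F. smul (u x) x)"
proof -
  obtain y where y: "bij_betw y {1..card F} F"
    using F(1) ex_bij_betw_nat_finite_1 by blast
  then have "inj_on y {1..card F} \<and> y ` {1..card F} \<subseteq> X"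
    using F(2) by (auto simp: bij_betw_def)
  then have "(\<Sum>n=1..card F. norm (u (y n))) \<le> K * norm (\<Sum>n=1..card F. smul (u (y n)) (y n))"
    using X unfolding l1_base_def by (elim conjE allE[of _ "card F"] allE[of _ "\<lambda>n. u (y n)"] allE[of _ y]) (simp del: One_nat_def)
  then show ?thesis
    by (simp del: One_nat_def add: sum.reindex_bij_betw[OF y, of "\<lambda>x. norm (u x)"]
        sum.reindex_bij_betw[OF y, of "\<lambda>x. smul (u x) x"])
qed

text \<open>The \<open>\<ell>\<^sup>1\<close> inequality bounds all coefficients of a vanishing
  combination by \<open>0\<close>. Independence is what allows functionals on the span to be
  prescribed freely on \<open>X\<close>.\<close>

lemma l1_base_independent:
  assumes X: "l1_base smul \<eta> K X"
  shows "independent X"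
  unfolding independent_explicit_module
proof (intro allI impI)
  fix F u x assume F: "finite F" "F \<subseteq> X" and "(\<Sum>v\<in>F. smul (u v) v) = 0" and x: "x \<in> F"
  then have "(\<Sum>v\<in>F. norm (u v)) \<le> 0"
    using l1_base_sum[OF X F, of u] by simp
  moreover have "norm (u x) \<le> (\<Sum>v\<in>F. norm (u v))"
    using F x by (intro member_le_sum) auto
  ultimately show "u x = 0"
    using norm_ge_zero[of "u x"] by (metis norm_le_zero_iff order_trans)
qed

text \<open>For independent \<open>X\<close> this is the linear extension of \<open>g\<close> from
  \<open>X\<close> to its span. Outside the span \<open>representation\<close> is \<open>0\<close>,
  which yields the value \<open>0\<close> there that \<open>dual_space\<close> asks for.\<close>

definition base_functional :: "'a set \<Rightarrow> ('a \<Rightarrow> 'k) \<Rightarrow> 'a \<Rightarrow> 'k" where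
  "base_functional X g v = (\<Sum>x | representation X v x \<noteq> 0. representation X v x * g x)"

lemma base_functional_eq:
  assumes "finite F" and "{x. representation X v x \<noteq> 0} \<subseteq> F"
  shows "base_functional X g v = (\<Sum>x\<in>F. representation X v x * g x)"
  unfolding base_functional_def using assms by (intro sum.mono_neutral_left) auto

lemma base_functional_plus: "base_functional X (g + h) = base_functional X g + base_functional X h"
  by (auto simp: base_functional_def fun_eq_iff distrib_left sum.distrib)

lemma base_functional_scale: "base_functional X (fun_scale c g) = fun_scale c (base_functional X g)"
  by (auto simp: base_functional_def fun_eq_iff fun_scale_def sum_distrib_left mult.left_commute)

lemma base_functional_base:
  assumes "independent X" and "x \<in> X"
  shows "base_functional X g x = g x"
  using assms by (simp add: base_functional_def representation_basis)

text \<open>This is the duality between \<open>\<ell>\<^sup>1\<close> and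
  \<open>\<ell>\<^sup>\<infinity>\<close>: the coefficients of \<open>v\<close> have absolute sum at
  most \<open>K * norm v\<close>, and they are weighted by values of size at most \<open>B\<close>.
  With \<open>B\<close> the norm of \<open>c\<close> it supplies the upper constant of the
  isomorphism.\<close>

lemma base_functional_bound:
  assumes X: "l1_base smul \<eta> K X" and g: "\<And>x. x \<in> X \<Longrightarrow> norm (g x) \<le> B" and "0 \<le> B"
    and v: "v \<in> span X"
  shows "norm (base_functional X g v) \<le> (K * B) * norm v"
proof -
  let ?R = "representation X v" and ?F = "{x. representation X v x \<noteq> 0}"
  have F: "finite ?F" "?F \<subseteq> X"
    using finite_representation representation_ne_zero by auto
  have "norm (base_functional X g v) \<le> (\<Sum>x\<in>?F. norm (?R x) * norm (g x))"
    unfolding base_functional_def norm_mult[symmetric] by (rule norm_sum)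
  also have "\<dots> \<le> (\<Sum>x\<in>?F. norm (?R x) * B)"
    using g F by (intro sum_mono mult_left_mono) auto
  also have "\<dots> = B * (\<Sum>x\<in>?F. norm (?R x))"
    by (simp add: sum_distrib_left mult.commute)
  also have "\<dots> \<le> B * (K * norm (\<Sum>x\<in>?F. smul (?R x) x))"
    by (intro mult_left_mono l1_base_sum[OF X F] \<open>0 \<le> B\<close>)
  also have "(\<Sum>x\<in>?F. smul (?R x) x) = v"
    by (rule sum_nonzero_representation_eq[OF l1_base_independent[OF X] v])
  finally show ?thesis by (simp add: ac_simps)
qed

lemma base_functional_dual:
  assumes X: "l1_base smul \<eta> K X" and g: "\<And>x. x \<in> X \<Longrightarrow> norm (g x) \<le> B" and "0 \<le> B"
  shows "base_functional X g \<in> span_dual smul X"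
proof -
  note ind = l1_base_independent[OF X]
  have "base_functional X g (u + v) = base_functional X g u + base_functional X g v"
    if "u \<in> span X" "v \<in> span X" for u v
  proof -
    let ?F = "{x. representation X u x \<noteq> 0} \<union> {x. representation X v x \<noteq> 0}"
    have "finite ?F"
      by (simp add: finite_representation)
    moreover have "{x. representation X (u + v) x \<noteq> 0} \<subseteq> ?F"
      by (auto simp: representation_add[OF ind that(2,1)])
    ultimately show ?thesis
      by (simp add: base_functional_eq[of ?F] representation_add[OF ind that(2,1)] distrib_right sum.distrib)
  qed
  moreover have "base_functional X g (smul c v) = c * base_functional X g v" if "v \<in> span X" for c v
  proof -
    have "{x. representation X (smul c v) x \<noteq> 0} \<subseteq> {x. representation X v x \<noteq> 0}"
      by (auto simp: representation_scale[OF ind that])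
    then have "base_functional X g (smul c v)
        = (\<Sum>x | representation X v x \<noteq> 0. representation X (smul c v) x * g x)"
      by (rule base_functional_eq[OF finite_representation])
    then show ?thesis
      by (simp add: representation_scale[OF ind that] base_functional_def sum_distrib_left mult.assoc)
  qed
  moreover have "\<exists>C. \<forall>v\<in>span X. norm (base_functional X g v) \<le> C * norm v"
    using base_functional_bound[OF X, of g B] g \<open>0 \<le> B\<close> by blast
  moreover have "base_functional X g v = 0" if "v \<notin> span X" for v
    using that by (simp add: base_functional_def representation_def)
  ultimately show ?thesis
    by (auto simp: span_dual_def dual_space_def)
qed

end

section \<open>Separating the two triangles\<close>

text \<open>A cofinal set meets every tail, so restricting the net filter to it leaves a proper
  filter, which an ultrafilter refines.\<close>

lemma cofinal_ultrafilter:
  assumes "\<Lambda> \<noteq> {}" and "trans r"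
    and dir: "\<And>\<alpha> \<beta>. \<alpha> \<in> \<Lambda> \<Longrightarrow> \<beta> \<in> \<Lambda> \<Longrightarrow> \<exists>\<gamma>\<in>\<Lambda>. (\<alpha>, \<gamma>) \<in> r \<and> (\<beta>, \<gamma>) \<in> r"
    and P: "\<And>\<xi>. \<xi> \<in> \<Lambda> \<Longrightarrow> \<exists>\<gamma>\<in>\<Lambda>. (\<xi>, \<gamma>) \<in> r \<and> P \<gamma>"
  obtains U where "ultrafilter U" and "U \<le> net_filter r \<Lambda>" and "\<forall>\<^sub>F \<alpha> in U. \<alpha> \<in> \<Lambda> \<and> P \<alpha>"
proof -
  note ev = eventually_net_filter[OF assms(1-3)]
  have "inf (net_filter r \<Lambda>) (principal {\<alpha> \<in> \<Lambda>. P \<alpha>}) \<noteq> bot"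
    using P by (auto simp: trivial_limit_def eventually_inf_principal ev)
  then obtain U where "ultrafilter U" "U \<le> inf (net_filter r \<Lambda>) (principal {\<alpha> \<in> \<Lambda>. P \<alpha>})"
    by (rule ultrafilter_exists_le)
  then show thesis
    by (intro that) (auto simp: le_principal)
qed

context banach_algebra
begin

text \<open>This passes from the approximants \<open>y\<close>, where a bound is known, to the
  products \<open>w\<close>, whose limits can be interchanged: \<open>f\<close> maps their
  difference to a null family.\<close>

lemma Lim_near_bound:
  assumes V: "ultrafilter V" and f: "f \<in> banach_dual smul"
    and w: "\<forall>\<^sub>F j in V. norm (w j) \<le> R"
    and near: "((\<lambda>j. norm (y j - w j)) \<longlongrightarrow> 0) V"
    and bd: "\<forall>\<^sub>F j in V. norm (z + f (y j)) \<le> B"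
  shows "norm (z + Lim V (\<lambda>j. f (w j))) \<le> B"
proof -
  have "((\<lambda>j. f (y j - w j)) \<longlongrightarrow> 0) V"
  proof (rule Lim_null_comparison)
    show "\<forall>\<^sub>F j in V. norm (f (y j - w j)) \<le> dual_norm UNIV norm f * norm (y j - w j)"
      by (simp add: banach_dual_bound[OF f])
    show "((\<lambda>j. dual_norm UNIV norm f * norm (y j - w j)) \<longlongrightarrow> 0) V"
      using tendsto_mult_left[OF near, of "dual_norm UNIV norm f"] by simp
  qed
  then have "((\<lambda>j. f (y j - w j) + f (w j)) \<longlongrightarrow> 0 + Lim V (\<lambda>j. f (w j))) V"
    by (intro tendsto_add dual_tendsto_Lim(1)[OF V w f])
  then have "((\<lambda>j. z + f (y j)) \<longlongrightarrow> z + Lim V (\<lambda>j. f (w j))) V"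
    by (intro tendsto_add tendsto_const) (simp add: banach_dual_diff[OF f])
  with ultrafilter_not_bot[OF V] show ?thesis
    using bd by (rule Lim_norm_ubound)
qed

text \<open>Fix \<open>\<alpha>\<close> with \<open>P \<alpha>\<close>: the upper approximants along
  \<open>V\<close> bound \<open>z\<close> plus the inner limit, and the outer limit along
  \<open>U\<close> gives \<open>norm (z + L) \<le> B\<close>. The lower approximants, used in the
  other order, give \<open>norm (- z + L) \<le> B\<close> with the same \<open>L\<close>, because
  the iterated limits agree. Subtracting removes \<open>L\<close>, and the factor \<open>2\<close>
  on \<open>z\<close> absorbs the sum of the two bounds.\<close>

lemma triangle_separation:
  fixes r :: "'i rel"
  assumes f: "f \<in> banach_dual smul" and ilim: "iterated_limits_agree f TYPE('i)"
    and "trans r"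
    and ne: "\<Lambda>1 \<noteq> {}" "\<Lambda>2 \<noteq> {}"
    and dir1: "\<And>\<alpha> \<beta>. \<alpha> \<in> \<Lambda>1 \<Longrightarrow> \<beta> \<in> \<Lambda>1 \<Longrightarrow> \<exists>\<gamma>\<in>\<Lambda>1. (\<alpha>, \<gamma>) \<in> r \<and> (\<beta>, \<gamma>) \<in> r"
    and dir2: "\<And>\<alpha> \<beta>. \<alpha> \<in> \<Lambda>2 \<Longrightarrow> \<beta> \<in> \<Lambda>2 \<Longrightarrow> \<exists>\<gamma>\<in>\<Lambda>2. (\<alpha>, \<gamma>) \<in> r \<and> (\<beta>, \<gamma>) \<in> r"
    and P: "\<And>\<xi>. \<xi> \<in> \<Lambda>1 \<Longrightarrow> \<exists>\<gamma>\<in>\<Lambda>1. (\<xi>, \<gamma>) \<in> r \<and> P \<gamma>"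
    and Q: "\<And>\<xi>. \<xi> \<in> \<Lambda>2 \<Longrightarrow> \<exists>\<gamma>\<in>\<Lambda>2. (\<xi>, \<gamma>) \<in> r \<and> Q \<gamma>"
    and a: "bounded (a ` \<Lambda>1)" and b: "bounded (b ` \<Lambda>2)"
    and up: "approximates_upper_by r \<Lambda>1 \<Lambda>2 a b X1 U1 x1"
    and low: "approximates_lower_by r \<Lambda>1 \<Lambda>2 a b X2 U2 x2"
    and z1: "\<And>\<alpha> \<beta>. (\<alpha>, \<beta>) \<in> U1 \<Longrightarrow> P \<alpha> \<Longrightarrow> Q \<beta> \<Longrightarrow> norm (z + f (x1 \<alpha> \<beta>)) \<le> B"
    and z2: "\<And>\<alpha> \<beta>. (\<alpha>, \<beta>) \<in> U2 \<Longrightarrow> P \<alpha> \<Longrightarrow> Q \<beta> \<Longrightarrow> norm (- z + f (x2 \<alpha> \<beta>)) \<le> B"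
  shows "norm z \<le> B"
proof -
  obtain U where U: "ultrafilter U" "U \<le> net_filter r \<Lambda>1" and evU: "\<forall>\<^sub>F \<alpha> in U. \<alpha> \<in> \<Lambda>1 \<and> P \<alpha>"
    using cofinal_ultrafilter[OF ne(1) \<open>trans r\<close> dir1 P] by blast
  obtain V where V: "ultrafilter V" "V \<le> net_filter r \<Lambda>2" and evV: "\<forall>\<^sub>F \<beta> in V. \<beta> \<in> \<Lambda>2 \<and> Q \<beta>"
    using cofinal_ultrafilter[OF ne(2) \<open>trans r\<close> dir2 Q] by blast
  obtain Ra Rb where Ra: "\<And>\<alpha>. \<alpha> \<in> \<Lambda>1 \<Longrightarrow> norm (a \<alpha>) \<le> Ra" and Rb: "\<And>\<beta>. \<beta> \<in> \<Lambda>2 \<Longrightarrow> norm (b \<beta>) \<le> Rb"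
    using a b by (auto simp: bounded_iff)
  define R where "R = max Ra Rb"
  have R: "\<And>\<alpha>. \<alpha> \<in> \<Lambda>1 \<Longrightarrow> norm (a \<alpha>) \<le> R" "\<And>\<beta>. \<beta> \<in> \<Lambda>2 \<Longrightarrow> norm (b \<beta>) \<le> R"
    using Ra Rb by (auto simp: R_def le_max_iff_disj)
  have evaR: "\<forall>\<^sub>F \<alpha> in U. norm (a \<alpha>) \<le> R" and evbR: "\<forall>\<^sub>F \<beta> in V. norm (b \<beta>) \<le> R"
    using evU evV R by (auto elim: eventually_mono)
  have prod: "norm (a \<alpha> * b \<beta>) \<le> R * R" if "\<alpha> \<in> \<Lambda>1" "\<beta> \<in> \<Lambda>2" for \<alpha> \<beta>
    using R(1)[OF that(1)] R(2)[OF that(2)] norm_ge_zero[of "a \<alpha>"] norm_ge_zero[of "b \<beta>"]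
    by (intro order_trans[OF norm_mult_ineq] mult_mono) linarith+
  define L where "L = Lim U (\<lambda>\<alpha>. Lim V (\<lambda>\<beta>. f (a \<alpha> * b \<beta>)))"
  have L': "L = Lim V (\<lambda>\<beta>. Lim U (\<lambda>\<alpha>. f (a \<alpha> * b \<beta>)))"
    using ilim U(1) V(1) evaR evbR unfolding iterated_limits_agree_def L_def by blast
  \<comment> \<open>The second estimate bounds the inner limits uniformly in
    \<open>\<alpha>\<close>, which makes the outer limit along \<open>U\<close> exist.\<close>
  have "norm (z + Lim V (\<lambda>\<beta>. f (a \<alpha> * b \<beta>))) \<le> B"
    and bnd1: "norm (Lim V (\<lambda>\<beta>. f (a \<alpha> * b \<beta>))) \<le> R * R * dual_norm UNIV norm f"
    if \<alpha>: "\<alpha> \<in> \<Lambda>1" "P \<alpha>" for \<alpha>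
  proof -
    have evp: "\<forall>\<^sub>F \<beta> in V. norm (a \<alpha> * b \<beta>) \<le> R * R"
      using evV by (rule eventually_mono) (use prod \<alpha> in blast)
    then show "norm (Lim V (\<lambda>\<beta>. f (a \<alpha> * b \<beta>))) \<le> R * R * dual_norm UNIV norm f"
      by (rule dual_tendsto_Lim(2)[OF V(1) _ f])
    obtain \<beta>0 where \<beta>0: "\<beta>0 \<in> \<Lambda>2" "\<And>\<beta>. \<beta> \<in> \<Lambda>2 \<Longrightarrow> (\<beta>0, \<beta>) \<in> r \<Longrightarrow> (\<alpha>, \<beta>) \<in> U1"
      using up \<alpha> unfolding approximates_upper_by_def vertically_cofinal_def by meson
    then have "\<forall>\<^sub>F \<beta> in net_filter r \<Lambda>2. (\<alpha>, \<beta>) \<in> U1"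
      using eventually_net_filter[OF ne(2) \<open>trans r\<close> dir2] by blast
    then have "\<forall>\<^sub>F \<beta> in V. (\<alpha>, \<beta>) \<in> U1"
      using V(2) by (simp add: le_filter_def)
    then have "\<forall>\<^sub>F \<beta> in V. norm (z + f (x1 \<alpha> \<beta>)) \<le> B"
      using evV by eventually_elim (use z1 \<alpha> in blast)
    moreover have "((\<lambda>\<beta>. norm (x1 \<alpha> \<beta> - a \<alpha> * b \<beta>)) \<longlongrightarrow> 0) V"
      using up \<alpha> V(2) unfolding approximates_upper_by_def by (blast intro: tendsto_mono)
    ultimately show "norm (z + Lim V (\<lambda>\<beta>. f (a \<alpha> * b \<beta>))) \<le> B"
      by (intro Lim_near_bound[OF V(1) f evp])
  qed
  then have "\<forall>\<^sub>F \<alpha> in U. norm (z + Lim V (\<lambda>\<beta>. f (a \<alpha> * b \<beta>))) \<le> B"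
    and "\<forall>\<^sub>F \<alpha> in U. norm (Lim V (\<lambda>\<beta>. f (a \<alpha> * b \<beta>))) \<le> R * R * dual_norm UNIV norm f"
    using evU by (auto elim: eventually_mono)
  then have 1: "norm (z + L) \<le> B"
    unfolding L_def using ultrafilter_not_bot[OF U(1)]
    by (intro Lim_norm_ubound[OF _ tendsto_add[OF tendsto_const ultrafilter_tendsto_Lim[OF U(1)]]])
  have "norm (- z + Lim U (\<lambda>\<alpha>. f (a \<alpha> * b \<beta>))) \<le> B"
    and "norm (Lim U (\<lambda>\<alpha>. f (a \<alpha> * b \<beta>))) \<le> R * R * dual_norm UNIV norm f"
    if \<beta>: "\<beta> \<in> \<Lambda>2" "Q \<beta>" for \<beta>
  proof -
    have evp: "\<forall>\<^sub>F \<alpha> in U. norm (a \<alpha> * b \<beta>) \<le> R * R"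
      using evU by (rule eventually_mono) (use prod \<beta> in blast)
    then show "norm (Lim U (\<lambda>\<alpha>. f (a \<alpha> * b \<beta>))) \<le> R * R * dual_norm UNIV norm f"
      by (rule dual_tendsto_Lim(2)[OF U(1) _ f])
    obtain \<alpha>0 where \<alpha>0: "\<alpha>0 \<in> \<Lambda>1" "\<And>\<alpha>. \<alpha> \<in> \<Lambda>1 \<Longrightarrow> (\<alpha>0, \<alpha>) \<in> r \<Longrightarrow> (\<alpha>, \<beta>) \<in> U2"
      using low \<beta> unfolding approximates_lower_by_def horizontally_cofinal_def by meson
    then have "\<forall>\<^sub>F \<alpha> in net_filter r \<Lambda>1. (\<alpha>, \<beta>) \<in> U2"
      using eventually_net_filter[OF ne(1) \<open>trans r\<close> dir1] by blast
    then have "\<forall>\<^sub>F \<alpha> in U. (\<alpha>, \<beta>) \<in> U2"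
      using U(2) by (simp add: le_filter_def)
    then have "\<forall>\<^sub>F \<alpha> in U. norm (- z + f (x2 \<alpha> \<beta>)) \<le> B"
      using evU by eventually_elim (use z2 \<beta> in blast)
    moreover have "((\<lambda>\<alpha>. norm (x2 \<alpha> \<beta> - a \<alpha> * b \<beta>)) \<longlongrightarrow> 0) U"
      using low \<beta> U(2) unfolding approximates_lower_by_def by (blast intro: tendsto_mono)
    ultimately show "norm (- z + Lim U (\<lambda>\<alpha>. f (a \<alpha> * b \<beta>))) \<le> B"
      by (intro Lim_near_bound[OF U(1) f evp])
  qed
  then have "\<forall>\<^sub>F \<beta> in V. norm (- z + Lim U (\<lambda>\<alpha>. f (a \<alpha> * b \<beta>))) \<le> B"
    and "\<forall>\<^sub>F \<beta> in V. norm (Lim U (\<lambda>\<alpha>. f (a \<alpha> * b \<beta>))) \<le> R * R * dual_norm UNIV norm f"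
    using evV by (auto elim: eventually_mono)
  then have 2: "norm (- z + L) \<le> B"
    unfolding L' using ultrafilter_not_bot[OF V(1)]
    by (intro Lim_norm_ubound[OF _ tendsto_add[OF tendsto_const ultrafilter_tendsto_Lim[OF V(1)]]])
  have "2 * norm z = norm ((z + L) - (- z + L))"
    by (simp add: norm_mult flip: mult_2)
  also have "\<dots> \<le> norm (z + L) + norm (- z + L)"
    by (rule norm_triangle_ineq4)
  finally show ?thesis
    using 1 2 by linarith
qed

end

section \<open>Quotients and the isomorphic embedding\<close>

lemma quot_add_coset:
  fixes W :: "('v \<Rightarrow> 'k::ab_group_add) set"
  assumes "0 \<in> W" and "\<And>f g. f \<in> W \<Longrightarrow> g \<in> W \<Longrightarrow> f + g \<in> W"
  shows "quot_add {f + w | w. w \<in> W} {g + w | w. w \<in> W} = {(f + g) + w | w. w \<in> W}"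
proof (rule set_eqI)
  fix h
  show "h \<in> quot_add {f + w | w. w \<in> W} {g + w | w. w \<in> W} \<longleftrightarrow> h \<in> {(f + g) + w | w. w \<in> W}"
  proof
    assume "h \<in> quot_add {f + w | w. w \<in> W} {g + w | w. w \<in> W}"
    then obtain u w where uw: "u \<in> W" "w \<in> W" and h: "h = (f + u) + (g + w)"
      by (auto simp: quot_add_def)
    have "h = (f + g) + (u + w)"
      unfolding h by (simp add: fun_eq_iff algebra_simps)
    then show "h \<in> {(f + g) + w | w. w \<in> W}"
      using assms(2)[OF uw] by blast
  next
    assume "h \<in> {(f + g) + w | w. w \<in> W}"
    then obtain w where w: "w \<in> W" and h: "h = (f + g) + w"
      by blast
    have "h = (f + 0) + (g + w)"
      unfolding h by (simp add: fun_eq_iff algebra_simps)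
    then show "h \<in> quot_add {f + w | w. w \<in> W} {g + w | w. w \<in> W}"
      using w assms(1) unfolding quot_add_def by blast
  qed
qed

lemma quot_scale_coset:
  fixes W :: "('v \<Rightarrow> 'k::comm_ring) set"
  assumes "0 \<in> W" and "\<And>f g. f \<in> W \<Longrightarrow> g \<in> W \<Longrightarrow> f + g \<in> W" and "\<And>f. f \<in> W \<Longrightarrow> fun_scale c f \<in> W"
  shows "quot_scale W c {f + w | w. w \<in> W} = {fun_scale c f + w | w. w \<in> W}"
proof (rule set_eqI)
  fix h
  show "h \<in> quot_scale W c {f + w | w. w \<in> W} \<longleftrightarrow> h \<in> {fun_scale c f + w | w. w \<in> W}"
  proof
    assume "h \<in> quot_scale W c {f + w | w. w \<in> W}"
    then obtain u w where uw: "u \<in> W" "w \<in> W" and h: "h = fun_scale c (f + u) + w"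
      by (auto simp: quot_scale_def)
    have "h = fun_scale c f + (fun_scale c u + w)"
      unfolding h by (simp add: fun_eq_iff fun_scale_def algebra_simps)
    then show "h \<in> {fun_scale c f + w | w. w \<in> W}"
      using assms(2)[OF assms(3)[OF uw(1)] uw(2)] by blast
  next
    assume "h \<in> {fun_scale c f + w | w. w \<in> W}"
    then obtain w where w: "w \<in> W" and h: "h = fun_scale c f + w"
      by blast
    have "h = fun_scale c (f + 0) + w"
      unfolding h by (simp add: fun_eq_iff)
    then show "h \<in> quot_scale W c {f + w | w. w \<in> W}"
      using w assms(1) unfolding quot_scale_def by blast
  qed
qed

text \<open>The map \<open>i\<close> picks an arbitrary index pair of each element; injectivity
  fixes one coordinate of that pair, and the colour is read off there with \<open>q\<close> or with
  \<open>p\<close>. If \<open>p \<alpha> = q \<beta>\<close>, both readings agree. As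
  \<open>p\<close> and \<open>q\<close> map everything into \<open>E\<close>, the colour stays in
  \<open>E\<close> even for elements without an index.\<close>

lemma injective_index_colouring:
  assumes inj: "vertically_injective U x \<or> horizontally_injective U x"
    and E: "\<And>\<alpha>. p \<alpha> \<in> E" "\<And>\<beta>. q \<beta> \<in> E"
  obtains \<pi> where "\<And>y. \<pi> y \<in> E"
    and "\<And>\<alpha> \<beta>. (\<alpha>, \<beta>) \<in> U \<Longrightarrow> p \<alpha> = q \<beta> \<Longrightarrow> \<pi> (x \<alpha> \<beta>) = p \<alpha>"
proof -
  define i where "i = inv_into U (case_prod x)"
  have i: "i (x \<alpha> \<beta>) \<in> U" "x (fst (i (x \<alpha> \<beta>))) (snd (i (x \<alpha> \<beta>))) = x \<alpha> \<beta>" if "(\<alpha>, \<beta>) \<in> U" for \<alpha> \<beta>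
  proof -
    have im: "x \<alpha> \<beta> \<in> case_prod x ` U"
      using that by (rule rev_image_eqI) simp
    show "i (x \<alpha> \<beta>) \<in> U" "x (fst (i (x \<alpha> \<beta>))) (snd (i (x \<alpha> \<beta>))) = x \<alpha> \<beta>"
      using inv_into_into[OF im] f_inv_into_f[OF im] by (auto simp: i_def case_prod_unfold)
  qed
  show thesis
    using inj
  proof
    assume v: "vertically_injective U x"
    have "snd (i (x \<alpha> \<beta>)) = \<beta>" if "(\<alpha>, \<beta>) \<in> U" for \<alpha> \<beta>
      using v i[OF that] that unfolding vertically_injective_def by (metis prod.collapse)
    then show thesis
      using E by (intro that[of "\<lambda>y. q (snd (i y))"]) auto
  next
    assume h: "horizontally_injective U x"
    have "fst (i (x \<alpha> \<beta>)) = \<alpha>" if "(\<alpha>, \<beta>) \<in> U" for \<alpha> \<beta>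
      using h i[OF that] that unfolding horizontally_injective_def by (metis prod.collapse)
    then show thesis
      using E by (intro that[of "\<lambda>y. p (fst (i y))"]) auto
  qed
qed

context banach_algebra
begin

lemma restrict_span_dual:
  assumes "f \<in> banach_dual smul"
  shows "restrict0 (span X) f \<in> span_dual smul X"
proof -
  have "\<exists>C. \<forall>v\<in>span X. norm (f v) \<le> C * norm v"
    using banach_dual_bound[OF assms] by blast
  then show ?thesis
    by (auto simp: span_dual_def dual_space_def restrict0_def span_add span_scale
        banach_dual_add[OF assms] banach_dual_scale[OF assms])
qed

lemma WAP_on_span_zero: "0 \<in> WAP_on_span smul X"
  unfolding WAP_on_span_def using WAP_zero by (rule rev_image_eqI) (simp add: restrict0_def fun_eq_iff)

lemma WAP_on_span_plus:
  assumes "f \<in> WAP_on_span smul X" and "g \<in> WAP_on_span smul X"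
  shows "f + g \<in> WAP_on_span smul X"
proof -
  obtain u v where uv: "u \<in> WAP smul" "v \<in> WAP smul"
    and "f = restrict0 (span X) u" "g = restrict0 (span X) v"
    using assms by (auto simp: WAP_on_span_def)
  then have "f + g = restrict0 (span X) (u + v)"
    by (simp add: restrict0_def fun_eq_iff)
  then show ?thesis
    using WAP_plus[OF uv] by (simp add: WAP_on_span_def)
qed

lemma WAP_on_span_scale:
  assumes "f \<in> WAP_on_span smul X"
  shows "fun_scale c f \<in> WAP_on_span smul X"
proof -
  obtain u where u: "u \<in> WAP smul" and "f = restrict0 (span X) u"
    using assms by (auto simp: WAP_on_span_def)
  then have "fun_scale c f = restrict0 (span X) (fun_scale c u)"
    by (simp add: restrict0_def fun_scale_def fun_eq_iff)
  then show ?thesis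
    using WAP_scale[OF u] by (simp add: WAP_on_span_def)
qed

end

theorem theorem3p9:
  fixes smul :: "'k::real_or_complex_field \<Rightarrow> 'a::{real_normed_algebra,banach} \<Rightarrow> 'a"
    and \<eta> :: "'e rel"
    and r :: "'i rel" and \<Lambda> \<Lambda>1 \<Lambda>2 :: "'i set"
    and a b :: "'i \<Rightarrow> 'a"
    and X1 X2 :: "'a set" and U1 U2 :: "('i \<times> 'i) set" and x1 x2 :: "'i \<Rightarrow> 'i \<Rightarrow> 'a"
    and K M :: real
  assumes "banach_algebra smul"
    and "Card_order \<eta>" and "infinite (Field \<eta>)"
    and "directed_set \<Lambda> r" and "cofinal_in r \<Lambda> \<Lambda>1" and "cofinal_in r \<Lambda> \<Lambda>2"
    and "is_true_cardinality r \<Lambda>1 \<eta>" and "is_true_cardinality r \<Lambda>2 \<eta>"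
    and "bounded (a ` \<Lambda>1)" and "bounded (b ` \<Lambda>2)"
    and "X1 \<inter> X2 = {}"
    and "K > 0" and "l1_base smul \<eta> K (X1 \<union> X2)"
    and "M > 0" and "X1 \<union> X2 \<subseteq> cball 0 M"
    and "approximates_upper_by r \<Lambda>1 \<Lambda>2 a b X1 U1 x1"
    and "approximates_lower_by r \<Lambda>1 \<Lambda>2 a b X2 U2 x2"
    and "vertically_injective U1 x1 \<and> horizontally_injective U2 x2 \<or>
         horizontally_injective U1 x1 \<and> vertically_injective U2 x2"
  shows "(\<exists>J :: ('e \<Rightarrow> 'k) \<Rightarrow> ('a \<Rightarrow> 'k) set.
      let X = X1 \<union> X2;
          W = WAP_on_span smul X;
          qn = quot_norm (dual_norm (module.span smul X) norm)
      in (\<forall>c\<in>linfty \<eta>. J c \<in> quot_carrier (span_dual smul X) W) \<and>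
         (\<forall>c\<in>linfty \<eta>. \<forall>d\<in>linfty \<eta>. J (c + d) = quot_add (J c) (J d)) \<and>
         (\<forall>z. \<forall>c\<in>linfty \<eta>. J (fun_scale z c) = quot_scale W z (J c)) \<and>
         (\<exists>K1>0. \<exists>K2>0. \<forall>c\<in>linfty \<eta>.
            K1 * linfty_norm \<eta> c \<le> qn (J c) \<and> qn (J c) \<le> K2 * linfty_norm \<eta> c))
    \<and> \<not> arens_regular smul"
proof -
  interpret banach_algebra smul by fact
  note up = \<open>approximates_upper_by r \<Lambda>1 \<Lambda>2 a b X1 U1 x1\<close>
    and low = \<open>approximates_lower_by r \<Lambda>1 \<Lambda>2 a b X2 U2 x2\<close>
    and base = \<open>l1_base smul \<eta> K (X1 \<union> X2)\<close>
  define X where "X = X1 \<union> X2"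
  define S where "S = span X"
  define W where "W = WAP_on_span smul X"
  have S: "subspace S" and XS: "x \<in> S" if "x \<in> X" for x
    using that by (auto simp: S_def span_base)
  have ind: "independent X"
    using base unfolding X_def by (rule l1_base_independent)
  have x1X: "x1 \<alpha> \<beta> \<in> X1" if "(\<alpha>, \<beta>) \<in> U1" for \<alpha> \<beta>
    using up that by (auto simp: approximates_upper_by_def)
  have x2X: "x2 \<alpha> \<beta> \<in> X2" if "(\<alpha>, \<beta>) \<in> U2" for \<alpha> \<beta>
    using low that by (auto simp: approximates_lower_by_def)
  have "trans r"
    using \<open>directed_set \<Lambda> r\<close> by (simp add: directed_set_def preorder_on_def)
  note dir1 = directed_set_cofinal[OF \<open>directed_set \<Lambda> r\<close> \<open>cofinal_in r \<Lambda> \<Lambda>1\<close>]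
    and dir2 = directed_set_cofinal[OF \<open>directed_set \<Lambda> r\<close> \<open>cofinal_in r \<Lambda> \<Lambda>2\<close>]
  have ne: "\<Lambda>1 \<noteq> {}" "\<Lambda>2 \<noteq> {}"
    using \<open>is_true_cardinality r \<Lambda>1 \<eta>\<close> \<open>is_true_cardinality r \<Lambda>2 \<eta>\<close>
    by (auto simp: is_true_cardinality_def)
  \<comment> \<open>The functional, its agreeing iterated limits, the cofinal conditions and the
    value bounds are left open: the fact is applied once for each of the two conclusions.\<close>
  note separation = triangle_separation[OF _ _ \<open>trans r\<close> ne dir1 dir2 _ _
      \<open>bounded (a ` \<Lambda>1)\<close> \<open>bounded (b ` \<Lambda>2)\<close> up low]

  \<comment> \<open>Colours of the index sets and of \<open>X\<close>\<close>
  obtain p where p: "\<And>\<alpha>. p \<alpha> \<in> Field \<eta>"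
    "\<And>\<xi> e. \<xi> \<in> \<Lambda>1 \<Longrightarrow> e \<in> Field \<eta> \<Longrightarrow> \<exists>\<gamma>\<in>\<Lambda>1. (\<xi>, \<gamma>) \<in> r \<and> p \<gamma> = e"
    using cofinal_fibres[OF \<open>Card_order \<eta>\<close> \<open>infinite (Field \<eta>)\<close>
        \<open>is_true_cardinality r \<Lambda>1 \<eta>\<close> \<open>trans r\<close> dir1] by blast
  obtain q where q: "\<And>\<beta>. q \<beta> \<in> Field \<eta>"
    "\<And>\<xi> e. \<xi> \<in> \<Lambda>2 \<Longrightarrow> e \<in> Field \<eta> \<Longrightarrow> \<exists>\<gamma>\<in>\<Lambda>2. (\<xi>, \<gamma>) \<in> r \<and> q \<gamma> = e"
    using cofinal_fibres[OF \<open>Card_order \<eta>\<close> \<open>infinite (Field \<eta>)\<close>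
        \<open>is_true_cardinality r \<Lambda>2 \<eta>\<close> \<open>trans r\<close> dir2] by blast
  have inj: "vertically_injective U1 x1 \<or> horizontally_injective U1 x1"
    "vertically_injective U2 x2 \<or> horizontally_injective U2 x2"
    using assms by blast+
  obtain \<pi>1 where \<pi>1: "\<And>y. \<pi>1 y \<in> Field \<eta>"
    "\<And>\<alpha> \<beta>. (\<alpha>, \<beta>) \<in> U1 \<Longrightarrow> p \<alpha> = q \<beta> \<Longrightarrow> \<pi>1 (x1 \<alpha> \<beta>) = p \<alpha>"
    using injective_index_colouring[OF inj(1), of p "Field \<eta>" q] p(1) q(1) by blast
  obtain \<pi>2 where \<pi>2: "\<And>y. \<pi>2 y \<in> Field \<eta>"
    "\<And>\<alpha> \<beta>. (\<alpha>, \<beta>) \<in> U2 \<Longrightarrow> p \<alpha> = q \<beta> \<Longrightarrow> \<pi>2 (x2 \<alpha> \<beta>) = p \<alpha>"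
    using injective_index_colouring[OF inj(2), of p "Field \<eta>" q] p(1) q(1) by blast

  \<comment> \<open>Opposite signs on the two triangles are what prevents \<open>\<Phi> c\<close>
    from being compensated by functionals with agreeing iterated limits. By disjointness the second
    clause covers all of \<open>X2\<close>, and since colours always lie in
    \<open>Field \<eta>\<close>, \<open>g c\<close> is bounded by the norm of
    \<open>c\<close>.\<close>
  define g :: "('e \<Rightarrow> 'k) \<Rightarrow> 'a \<Rightarrow> 'k"
    where "g c x = (if x \<in> X1 then c (\<pi>1 x) else - c (\<pi>2 x))" for c x
  define \<Phi> where "\<Phi> c = base_functional X (g c)" for c
  have \<Phi>_plus: "\<Phi> (c + d) = \<Phi> c + \<Phi> d" for c d
    unfolding \<Phi>_def base_functional_plus[symmetric]
    by (rule arg_cong[of _ _ "base_functional X"]) (auto simp: g_def fun_eq_iff)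
  have \<Phi>_scale: "\<Phi> (fun_scale z c) = fun_scale z (\<Phi> c)" for z c
    unfolding \<Phi>_def base_functional_scale[symmetric]
    by (rule arg_cong[of _ _ "base_functional X"]) (auto simp: g_def fun_scale_def fun_eq_iff)
  have \<Phi>_base: "\<Phi> c x = g c x" if "x \<in> X" for c x
    unfolding \<Phi>_def by (rule base_functional_base[OF ind that])
  have entry: "norm (c e) \<le> linfty_norm \<eta> c" if c: "c \<in> linfty \<eta>" and e: "e \<in> Field \<eta>" for c :: "'e \<Rightarrow> 'k" and e
  proof -
    obtain C where "\<And>e. e \<in> Field \<eta> \<Longrightarrow> norm (c e) \<le> C"
      using c by (auto simp: linfty_def bounded_iff)
    then have "bdd_above ((\<lambda>e. norm (c e)) ` Field \<eta>)"
      by (rule bdd_aboveI2)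
    then show ?thesis
      unfolding linfty_norm_def using e by (rule cSUP_upper[rotated])
  qed
  have Field_ne: "Field \<eta> \<noteq> {}"
    using \<open>infinite (Field \<eta>)\<close> by auto
  have linfty_norm_nonneg: "0 \<le> linfty_norm \<eta> c" if "c \<in> linfty \<eta>" for c :: "'e \<Rightarrow> 'k"
    using Field_ne entry[OF that] by (meson ex_in_conv norm_ge_zero order_trans)
  have g_bound: "norm (g c x) \<le> linfty_norm \<eta> c" if "c \<in> linfty \<eta>" for c x
    using entry[OF that] \<pi>1(1) \<pi>2(1) by (simp add: g_def)
  have \<Phi>_dual: "\<Phi> c \<in> span_dual smul X" if "c \<in> linfty \<eta>" for c
    unfolding \<Phi>_def using base g_bound[OF that] linfty_norm_nonneg[OF that]
    by (intro base_functional_dual) (auto simp: X_def)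
  have W_zero: "0 \<in> W" and W_plus: "\<And>f h. f \<in> W \<Longrightarrow> h \<in> W \<Longrightarrow> f + h \<in> W"
    and W_scale: "\<And>f z. f \<in> W \<Longrightarrow> fun_scale z f \<in> W"
    by (simp_all add: W_def WAP_on_span_zero WAP_on_span_plus WAP_on_span_scale)
  have coset_dual: "\<Phi> c + w \<in> dual_space smul S norm" if "c \<in> linfty \<eta>" "w \<in> W" for c w
  proof -
    have "w \<in> span_dual smul X"
      using that(2) restrict_span_dual[OF WAP_dual] by (auto simp: W_def WAP_on_span_def)
    then show ?thesis
      using \<Phi>_dual[OF that(1)] unfolding span_dual_def S_def by (intro dual_space_plus)
  qed

  \<comment> \<open>The lower estimate, one entry of \<open>c\<close> at a time\<close>
  have coset_lower: "norm (c e) \<le> dual_norm S norm (\<Phi> c + w) * M"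
    if c: "c \<in> linfty \<eta>" and w: "w \<in> W" and e: "e \<in> Field \<eta>" for c w e
  proof -
    obtain f where f: "f \<in> WAP smul" and wf: "w = restrict0 S f"
      using w by (auto simp: W_def WAP_on_span_def S_def)
    have val: "norm (g c x + f x) \<le> dual_norm S norm (\<Phi> c + w) * M" if "x \<in> X" for x
    proof -
      have "norm (g c x + f x) = norm ((\<Phi> c + w) x)"
        using that by (simp add: \<Phi>_base wf restrict0_def XS)
      also have "\<dots> \<le> dual_norm S norm (\<Phi> c + w) * norm x"
        by (rule dual_norm_bound[OF coset_dual[OF c w] _ XS[OF that]]) (simp add: S_def)
      also have "\<dots> \<le> dual_norm S norm (\<Phi> c + w) * M"
        using that \<open>X1 \<union> X2 \<subseteq> cball 0 M\<close> dual_norm_nonneg[OF coset_dual[OF c w]]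
        by (intro mult_left_mono) (auto simp: X_def S_def span_zero)
      finally show ?thesis .
    qed
    show ?thesis
    \<comment> \<open>On pairs of colour \<open>e\<close> the contribution of
      \<open>\<Phi> c\<close> is the constant \<open>z = c e\<close> or \<open>- z\<close>, so the
      limits involve only \<open>f\<close>, which is defined on the whole algebra.\<close>
    proof (rule separation[where P = "\<lambda>\<alpha>. p \<alpha> = e" and Q = "\<lambda>\<beta>. q \<beta> = e"])
      show "f \<in> banach_dual smul" "iterated_limits_agree f TYPE('i)"
        using f by (rule WAP_dual WAP_iterated_limits)+
      show "norm (c e + f (x1 \<alpha> \<beta>)) \<le> dual_norm S norm (\<Phi> c + w) * M"
        if "(\<alpha>, \<beta>) \<in> U1" "p \<alpha> = e" "q \<beta> = e" for \<alpha> \<beta>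
        using val[of "x1 \<alpha> \<beta>"] x1X[OF that(1)] \<pi>1(2)[OF that(1)] that by (simp add: g_def X_def)
      show "norm (- c e + f (x2 \<alpha> \<beta>)) \<le> dual_norm S norm (\<Phi> c + w) * M"
        if "(\<alpha>, \<beta>) \<in> U2" "p \<alpha> = e" "q \<beta> = e" for \<alpha> \<beta>
      proof -
        have "x2 \<alpha> \<beta> \<notin> X1"
          using x2X[OF that(1)] \<open>X1 \<inter> X2 = {}\<close> by blast
        then show ?thesis
          using val[of "x2 \<alpha> \<beta>"] x2X[OF that(1)] \<pi>2(2)[OF that(1)] that by (simp add: g_def X_def)
      qed
    qed (use p(2) q(2) e in auto)
  qed

  \<comment> \<open>The embedding into the quotient and its two constants\<close>
  define J where "J c = {\<Phi> c + w | w. w \<in> W}" for c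
  have lower: "(1 / M) * linfty_norm \<eta> c \<le> quot_norm (dual_norm S norm) (J c)" if c: "c \<in> linfty \<eta>" for c
    unfolding quot_norm_def
  proof (rule cINF_greatest)
    show "J c \<noteq> {}"
      using W_zero by (auto simp: J_def)
    fix h assume "h \<in> J c"
    then obtain w where "w \<in> W" "h = \<Phi> c + w"
      by (auto simp: J_def)
    then have "linfty_norm \<eta> c \<le> dual_norm S norm h * M"
      unfolding linfty_norm_def using coset_lower[OF c] by (intro cSUP_least Field_ne) auto
    then show "(1 / M) * linfty_norm \<eta> c \<le> dual_norm S norm h"
      using \<open>M > 0\<close> by (simp add: field_simps)
  qed
  have upper: "quot_norm (dual_norm S norm) (J c) \<le> K * linfty_norm \<eta> c" if c: "c \<in> linfty \<eta>" for c
  proof -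
    have "\<Phi> c + 0 \<in> J c"
      unfolding J_def using W_zero by blast
    moreover have "bdd_below (dual_norm S norm ` J c)"
      using dual_norm_nonneg[OF coset_dual[OF c]] span_zero
      by (auto simp: J_def S_def intro!: bdd_belowI2[where m = 0])
    ultimately have "quot_norm (dual_norm S norm) (J c) \<le> dual_norm S norm (\<Phi> c)"
      unfolding quot_norm_def by (metis add_0_right cINF_lower)
    also have "\<dots> \<le> K * linfty_norm \<eta> c"
      using base_functional_bound[OF base, of "g c" "linfty_norm \<eta> c"] g_bound[OF c]
        linfty_norm_nonneg[OF c] \<open>K > 0\<close> span_zero
      by (intro dual_norm_le) (auto simp: \<Phi>_def S_def X_def)
    finally show ?thesis .
  qed

  \<comment> \<open>Failure of Arens regularity\<close>
  have "\<not> arens_regular smul"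
  proof
    assume reg: "arens_regular smul"
    \<comment> \<open>With these signs \<open>1 + F\<close> vanishes on \<open>X1\<close> and
      \<open>- 1 + F\<close> vanishes on \<open>X2\<close>, so the separation applies with
      \<open>z = 1\<close> and bound \<open>0\<close>. As \<open>h\<close> does not depend on
      colours, the conditions \<open>P\<close> and \<open>Q\<close> can be trivial.\<close>
    define h :: "'a \<Rightarrow> 'k" where "h x = (if x \<in> X1 then - 1 else 1)" for x
    have "base_functional X h \<in> dual_space smul (span X) norm"
      using base_functional_dual[OF base, of h 1] by (simp add: h_def X_def span_dual_def)
    then obtain F where F: "F \<in> banach_dual smul" "\<And>v. v \<in> span X \<Longrightarrow> F v = base_functional X h v"
      using Hahn_Banach[OF _ subspace_span] by blast
    have Fx: "F x = h x" if "x \<in> X" for x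
      using F(2)[OF span_base[OF that]] base_functional_base[OF ind that] by simp
    have "norm (1 :: 'k) \<le> 0"
    proof (rule separation[where P = "\<lambda>_. True" and Q = "\<lambda>_. True"])
      show "F \<in> banach_dual smul" by fact
      show "iterated_limits_agree F TYPE('i)"
        by (rule arens_regular_iterated_limits[OF reg F(1)])
      show "norm (1 + F (x1 \<alpha> \<beta>)) \<le> 0" if "(\<alpha>, \<beta>) \<in> U1" for \<alpha> \<beta>
        using Fx[of "x1 \<alpha> \<beta>"] x1X[OF that] by (simp add: h_def X_def)
      show "norm (- 1 + F (x2 \<alpha> \<beta>)) \<le> 0" if "(\<alpha>, \<beta>) \<in> U2" for \<alpha> \<beta>
      proof -
        have "x2 \<alpha> \<beta> \<notin> X1"
          using x2X[OF that] \<open>X1 \<inter> X2 = {}\<close> by blast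
        then show ?thesis
          using Fx[of "x2 \<alpha> \<beta>"] x2X[OF that] by (simp add: h_def X_def)
      qed
    qed (use dir1 dir2 in blast)+
    then show False by simp
  qed
  moreover have "J c \<in> quot_carrier (span_dual smul X) W" if "c \<in> linfty \<eta>" for c
    using \<Phi>_dual[OF that] by (auto simp: quot_carrier_def J_def)
  moreover have "J (c + d) = quot_add (J c) (J d)" for c d
    unfolding J_def \<Phi>_plus using quot_add_coset[OF W_zero W_plus] by simp
  moreover have "J (fun_scale z c) = quot_scale W z (J c)" for z c
    unfolding J_def \<Phi>_scale using quot_scale_coset[OF W_zero W_plus W_scale] by simp
  moreover have "\<exists>K1>0. \<exists>K2>0. \<forall>c\<in>linfty \<eta>.
      K1 * linfty_norm \<eta> c \<le> quot_norm (dual_norm S norm) (J c) \<and>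
      quot_norm (dual_norm S norm) (J c) \<le> K2 * linfty_norm \<eta> c"
    using lower upper \<open>M > 0\<close> \<open>K > 0\<close>
    by (intro exI[of _ "1 / M"] exI[of _ K] conjI ballI) auto
  ultimately show ?thesis
    unfolding Let_def X_def[symmetric] W_def[symmetric] S_def[symmetric]
    by (intro conjI exI[of _ J]) auto
qed

end
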